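(* Let $\{\alpha_n\}_{n=0}^\infty$ be the Verblunsky coefficients of a nontrivial positive measure $\mu$ on the unit circle $\mathbb{T}$, and let $\vartheta_1,\vartheta_2$ be real numbers with $0<\vartheta_2-\vartheta_1\le2\pi$ and $0<\vartheta_2\le2\pi$. Put $$x(\vartheta_1,\vartheta_2):=\cos\big((2\pi+\vartheta_1-\vartheta_2)/2\big)$$ and, with $c_n^{(\vartheta)}$ and $\mathfrak{d}_{n+1}^{(\vartheta)}(x)$ as defined in the context, set $$\mathfrak{m}_0^{(\vartheta_1,\vartheta_2)}=0,\qquad \mathfrak{m}_n^{(\vartheta_1,\vartheta_2)}=\frac{\mathfrak{d}_{n+1}^{(\vartheta_2)}\big(x(\vartheta_1,\vartheta_2)\big)}{1-\mathfrak{m}_{n-1}^{(\vartheta_1,\vartheta_2)}},\quad n\ge1.$$ Then $$\operatorname{supp}\mu\cap\mathcal{A}(\vartheta_1,\vartheta_2)=\emptyset$$ if and only if $$\cot\big((2\pi+\vartheta_1-\vartheta_2)/2\big)<c_1^{(\vartheta_2)}\quad\text{and}\quad 0<\mathfrak{m}_n^{(\vartheta_1,\vartheta_2)}<1\ \text{ for all } n\ge1.$$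
   Context: $\mathbb{T}=\{|z|=1\}$; a measure on $\mathbb{T}$ is nontrivial if its support is infinite. $\mathcal{A}(\vartheta_1,\vartheta_2)=\{e^{i\theta}:\vartheta_1<\theta<\vartheta_2\}$. The Verblunsky coefficients are $\alpha_{n-1}=-\overline{\Phi_n(0)}$, $n\ge1$, where $\Phi_n$ are the monic orthogonal polynomials with respect to $\mu$; $|\alpha_n|<1$. For $0<\vartheta\le2\pi$ define $$\tau_0^{(\vartheta)}=e^{i\vartheta},\qquad \tau_n^{(\vartheta)}=e^{i\vartheta}\,\tau_{n-1}^{(\vartheta)}\,\frac{1-\overline{\tau_{n-1}^{(\vartheta)}\alpha_{n-1}}}{1-\tau_{n-1}^{(\vartheta)}\alpha_{n-1}},\quad n\ge1,$$ $$c_n^{(\vartheta)}=\frac{-\operatorname{Im}(\tau_{n-1}^{(\vartheta)}\alpha_{n-1})}{1-\operatorname{Re}(\tau_{n-1}^{(\vartheta)}\alpha_{n-1})},\qquad g_n^{(\vartheta)}=\frac12\,\frac{|1-\tau_{n-1}^{(\vartheta)}\alpha_{n-1}|^2}{1-\operatorname{Re}(\tau_{n-1}^{(\vartheta)}\alpha_{n-1})},\qquad d_{n+1}^{(\vartheta)}=(1-g_n^{(\vartheta)})g_{n+1}^{(\vartheta)},\quad n\ge1,$$ and for $x\in[-1,1]$ $$\mathfrak{d}_{n+1}^{(\vartheta)}(x)=\frac{d_{n+1}^{(\vartheta)}}{\big(x-c_n^{(\vartheta)}\sqrt{1-x^2}\big)\big(x-c_{n+1}^{(\vartheta)}\sqrt{1-x^2}\big)},\quad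 n\ge1.$$ Conventions: $\cot 0=+\infty$ (relevant only if $\vartheta_2-\vartheta_1=2\pi$). The condition "$0<\mathfrak{m}_n^{(\vartheta_1,\vartheta_2)}<1$ for all $n\ge1$" includes the requirement that all the quantities involved are well defined (no zero denominators). *)

theory Defs
  imports "HOL-Analysis.Analysis" "HOL-Computational_Algebra.Polynomial"
begin

definition circle_measure :: "complex measure \<Rightarrow> bool" where
  "circle_measure \<mu> \<longleftrightarrow>
     finite_measure \<mu> \<and> sets \<mu> = sets (restrict_space borel (sphere (0::complex) 1))"

definition supp :: "complex measure \<Rightarrow> complex set" where
  "supp \<mu> = {z \<in> space \<mu>. \<forall>U. open U \<and> z \<in> U \<longrightarrow> 0 < emeasure \<mu> (U \<inter> space \<mu>)}"

definition nontrivial :: "complex measure \<Rightarrow> bool" where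
  "nontrivial \<mu> \<longleftrightarrow> infinite (supp \<mu>)"

definition open_arc :: "real \<Rightarrow> real \<Rightarrow> complex set" where
  "open_arc \<theta>1 \<theta>2 = {cis \<theta> | \<theta>. \<theta>1 < \<theta> \<and> \<theta> < \<theta>2}"

text \<open>For a nontrivial measure on the circle the sequence of monic orthogonal polynomials
  exists and is unique.\<close>

definition monic_orthogonal_polys :: "complex measure \<Rightarrow> (nat \<Rightarrow> complex poly) \<Rightarrow> bool" where
  "monic_orthogonal_polys \<mu> \<Phi> \<longleftrightarrow>
     (\<forall>n. degree (\<Phi> n) = n \<and> lead_coeff (\<Phi> n) = 1) \<and>
     (\<forall>m n. m \<noteq> n \<longrightarrow> (LINT z|\<mu>. poly (\<Phi> n) z * cnj (poly (\<Phi> m) z)) = 0)"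

definition is_verblunsky :: "complex measure \<Rightarrow> (nat \<Rightarrow> complex) \<Rightarrow> bool" where
  "is_verblunsky \<mu> \<alpha> \<longleftrightarrow>
     (\<exists>\<Phi>. monic_orthogonal_polys \<mu> \<Phi> \<and> (\<forall>n\<ge>1. \<alpha> (n - 1) = - cnj (poly (\<Phi> n) 0)))"

primrec tau :: "(nat \<Rightarrow> complex) \<Rightarrow> real \<Rightarrow> nat \<Rightarrow> complex" where
  "tau \<alpha> \<theta> 0 = cis \<theta>"
| "tau \<alpha> \<theta> (Suc n) =
     cis \<theta> * tau \<alpha> \<theta> n * ((1 - cnj (tau \<alpha> \<theta> n * \<alpha> n)) / (1 - tau \<alpha> \<theta> n * \<alpha> n))"

text \<open>The sequences \<open>c_coef\<close> and \<open>g_coef\<close> are meaningful for indices \<open>n \<ge> 1\<close>,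
  \<open>d_coef\<close> and \<open>d_frak\<close> for \<open>n \<ge> 2\<close>.\<close>

definition c_coef :: "(nat \<Rightarrow> complex) \<Rightarrow> real \<Rightarrow> nat \<Rightarrow> real" where
  "c_coef \<alpha> \<theta> n =
     - Im (tau \<alpha> \<theta> (n - 1) * \<alpha> (n - 1)) / (1 - Re (tau \<alpha> \<theta> (n - 1) * \<alpha> (n - 1)))"

definition g_coef :: "(nat \<Rightarrow> complex) \<Rightarrow> real \<Rightarrow> nat \<Rightarrow> real" where
  "g_coef \<alpha> \<theta> n =
     1 / 2 * ((cmod (1 - tau \<alpha> \<theta> (n - 1) * \<alpha> (n - 1)))\<^sup>2
              / (1 - Re (tau \<alpha> \<theta> (n - 1) * \<alpha> (n - 1))))"

definition d_coef :: "(nat \<Rightarrow> complex) \<Rightarrow> real \<Rightarrow> nat \<Rightarrow> real" where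
  "d_coef \<alpha> \<theta> n = (1 - g_coef \<alpha> \<theta> (n - 1)) * g_coef \<alpha> \<theta> n"

definition d_frak :: "(nat \<Rightarrow> complex) \<Rightarrow> real \<Rightarrow> nat \<Rightarrow> real \<Rightarrow> real" where
  "d_frak \<alpha> \<theta> n x =
     d_coef \<alpha> \<theta> n /
     ((x - c_coef \<alpha> \<theta> (n - 1) * sqrt (1 - x\<^sup>2)) * (x - c_coef \<alpha> \<theta> n * sqrt (1 - x\<^sup>2)))"

definition half_angle :: "real \<Rightarrow> real \<Rightarrow> real" where
  "half_angle \<theta>1 \<theta>2 = (2 * pi + \<theta>1 - \<theta>2) / 2"

definition x_point :: "real \<Rightarrow> real \<Rightarrow> real" where
  "x_point \<theta>1 \<theta>2 = cos (half_angle \<theta>1 \<theta>2)"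

primrec m_seq :: "(nat \<Rightarrow> complex) \<Rightarrow> real \<Rightarrow> real \<Rightarrow> nat \<Rightarrow> real" where
  "m_seq \<alpha> \<theta>1 \<theta>2 0 = 0"
| "m_seq \<alpha> \<theta>1 \<theta>2 (Suc n) =
     d_frak \<alpha> \<theta>2 (Suc n + 1) (x_point \<theta>1 \<theta>2) / (1 - m_seq \<alpha> \<theta>1 \<theta>2 n)"

text \<open>HOL division is total, so the denominators entering \<open>m_seq\<close> at step \<open>n \<ge> 1\<close> are
  required to be nonzero explicitly.  The denominators of \<open>tau\<close>, \<open>c_coef\<close> and \<open>g_coef\<close>
  never vanish, because \<open>cmod (tau \<alpha> \<theta> n) = 1\<close> and \<open>cmod (\<alpha> n) < 1\<close>.\<close>

definition m_defined :: "(nat \<Rightarrow> complex) \<Rightarrow> real \<Rightarrow> real \<Rightarrow> nat \<Rightarrow> bool" where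
  "m_defined \<alpha> \<theta>1 \<theta>2 n \<longleftrightarrow>
     (let x = x_point \<theta>1 \<theta>2 in
        x - c_coef \<alpha> \<theta>2 n * sqrt (1 - x\<^sup>2) \<noteq> 0 \<and>
        x - c_coef \<alpha> \<theta>2 (n + 1) * sqrt (1 - x\<^sup>2) \<noteq> 0 \<and>
        1 - m_seq \<alpha> \<theta>1 \<theta>2 (n - 1) \<noteq> 0)"

text \<open>The library has \<open>cot 0 = 0\<close>; here \<open>cot 0\<close> is \<open>\<infinity>\<close>.\<close>

definition ecot :: "real \<Rightarrow> ereal" where
  "ecot t = (if t = 0 then \<infinity> else ereal (cot t))"

end

theory Submission
  imports Defs
begin

text \<open>Write \<open>\<zeta> = cis \<theta>1\<close> and \<open>w = cis \<theta>2\<close>. A suitable unimodular multiple of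
  \<open>(z - \<zeta>) * cnj (z - w)\<close> is a real function \<open>s\<close> on the circle that is negative exactly on the open arc.
  Hence the arc misses the support iff the form \<open>\<integral> s |p|\<^sup>2 d\<mu>\<close> is nonnegative on polynomials, and it is
  then positive definite, since the support is infinite.
  The polynomial \<open>S\<^sub>n(z) = \<Phi>\<^sub>n\<^sup>*(z) - cnj \<tau>\<^sub>n z \<Phi>\<^sub>n(z)\<close> vanishes at \<open>w\<close> and is orthogonal to
  \<open>z, \<dots>, z\<^sup>n\<close>, so \<open>(S\<^sub>n\<^sub>+\<^sub>1 - \<kappa> S\<^sub>n) / ((z - \<zeta>) (z - w))\<close>, with \<open>\<kappa>\<close> making the numerator vanish at
  \<open>\<zeta>\<close>, is the \<open>n\<close>-th orthogonal polynomial of the form, and its square norm is a negative multiple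
  of \<open>r\<^sub>n\<^sub>+\<^sub>1 / r\<^sub>n\<close>. Here \<open>r\<^sub>n\<close> is \<open>S\<^sub>n(\<zeta>)\<close> up to normalisation and solves the real
  recurrence \<open>r\<^sub>n\<^sub>+\<^sub>1 = (x - c\<^sub>n\<^sub>+\<^sub>1 \<surd>(1 - x\<^sup>2)) r\<^sub>n - d\<^sub>n\<^sub>+\<^sub>1 r\<^sub>n\<^sub>-\<^sub>1\<close>, whose ratios are encoded by the
  minimal parameters \<open>m\<^sub>n\<close>: positivity of the form is exactly the condition on the \<open>m\<^sub>n\<close>.\<close>

section \<open>Measures and polynomials on the circle\<close>

lemma sphere_cnj_mult:
  "z \<in> sphere (0::complex) 1 \<Longrightarrow> z * cnj z = 1"
  "z \<in> sphere (0::complex) 1 \<Longrightarrow> cnj z * z = 1"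
  using complex_norm_square[of z] by (auto simp: mult.commute)

text \<open>Subtracting \<open>coeff q n\<close> times \<open>P n\<close> lowers the degree, so a
  monic family with one member per degree spans. The degree bound is phrased through coefficients,
  so that \<open>n = 0\<close> means \<open>q = 0\<close>.\<close>

lemma monic_basis_induct:
  fixes P :: "nat \<Rightarrow> 'a::comm_ring_1 poly"
  assumes monic: "\<And>m. degree (P m) = m" "\<And>m. lead_coeff (P m) = 1"
    and V: "V 0" "\<And>q c m. m < n \<Longrightarrow> V q \<Longrightarrow> V (q + smult c (P m))"
    and low: "\<forall>k\<ge>n. coeff q k = 0"
  shows "V q"
  using V(2) low
proof (induction n arbitrary: q)
  case 0
  then have "q = 0" by (auto intro: poly_eqI)
  then show ?case using V(1) by simp
next
  case (Suc n)
  define r where "r = q - smult (coeff q n) (P n)"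
  have "\<forall>k\<ge>n. coeff r k = 0"
  proof (intro allI impI)
    fix k assume "n \<le> k"
    show "coeff r k = 0"
    proof (cases "k = n")
      case True then show ?thesis using monic[of n] by (simp add: r_def)
    next
      case False
      then show ?thesis using monic[of n] Suc.prems(2) \<open>n \<le> k\<close> by (simp add: r_def coeff_eq_0)
    qed
  qed
  then have "V r" using Suc.IH Suc.prems(1) by simp
  then have "V (r + smult (coeff q n) (P n))" by (rule Suc.prems(1)[rotated]) simp
  then show ?case by (simp add: r_def)
qed

text \<open>On the circle \<open>Re z\<close> and \<open>Im z\<close> are combinations of
  \<open>z\<close> and \<open>cnj z = 1/z\<close>, so a real polynomial in the coordinates is a
  Laurent polynomial; the factor \<open>cnj z ^ k\<close> absorbs the negative powers.\<close>

lemma real_polynomial_on_circle: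
  assumes "real_polynomial_function f"
  shows "\<exists>q k. \<forall>z\<in>sphere 0 1. complex_of_real (f z) = poly q z * cnj z ^ k"
  using assms
proof (induction rule: real_polynomial_function.induct)
  case (linear f)
  interpret bounded_linear f by fact
  let ?a = "complex_of_real (f 1)" and ?b = "complex_of_real (f \<i>)"
  show ?case
  proof (intro exI ballI)
    fix z :: complex assume z: "z \<in> sphere 0 1"
    have "z = Re z *\<^sub>R 1 + Im z *\<^sub>R \<i>" by (simp add: complex_eq_iff)
    then have "f z = f (Re z *\<^sub>R 1 + Im z *\<^sub>R \<i>)" by simp
    also have "\<dots> = Re z * f 1 + Im z * f \<i>" by (simp only: add scaleR real_scaleR_def)
    finally have 1: "of_real (f z) = of_real (Re z) * ?a + of_real (Im z) * ?b" by simp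
    have 2: "of_real (Re z) = (z + cnj z) / 2" "of_real (Im z) = (z - cnj z) / (2 * \<i>)"
      by (simp_all add: complex_eq_iff)
    have "poly [:(?a + \<i> * ?b)/2, 0, (?a - \<i> * ?b)/2:] z * cnj z ^ 1
        = (?a + \<i> * ?b)/2 * cnj z + (?a - \<i> * ?b)/2 * z * (z * cnj z)"
      by (simp add: algebra_simps)
    also have "\<dots> = of_real (f z)" unfolding 1 2 sphere_cnj_mult[OF z] by (simp add: field_simps)
    finally show "of_real (f z) = poly [:(?a + \<i> * ?b)/2, 0, (?a - \<i> * ?b)/2:] z * cnj z ^ 1" ..
  qed
next
  case (const c)
  show ?case by (intro exI[of _ "[:of_real c:]"] exI[of _ 0]) simp
next
  case (add f g)
  then obtain p k q l where
    f: "\<And>z. z \<in> sphere 0 1 \<Longrightarrow> complex_of_real (f z) = poly p z * cnj z ^ k" and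
    g: "\<And>z. z \<in> sphere 0 1 \<Longrightarrow> complex_of_real (g z) = poly q z * cnj z ^ l" by blast
  show ?case
  proof (intro exI ballI)
    fix z :: complex assume z: "z \<in> sphere 0 1"
    have e: "z ^ n * cnj z ^ n = 1" for n
      using sphere_cnj_mult[OF z] by (simp flip: power_mult_distrib)
    have "poly (p * monom 1 l + q * monom 1 k) z * cnj z ^ (k + l)
      = poly p z * cnj z ^ k * (z ^ l * cnj z ^ l) + poly q z * cnj z ^ l * (z ^ k * cnj z ^ k)"
      by (simp add: poly_monom algebra_simps power_add)
    then show "of_real (f z + g z) = poly (p * monom 1 l + q * monom 1 k) z * cnj z ^ (k + l)"
      using f[OF z] g[OF z] e by simp
  qed
next
  case (mult f g)
  then obtain p k q l where
    f: "\<And>z. z \<in> sphere 0 1 \<Longrightarrow> complex_of_real (f z) = poly p z * cnj z ^ k" and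
    g: "\<And>z. z \<in> sphere 0 1 \<Longrightarrow> complex_of_real (g z) = poly q z * cnj z ^ l" by blast
  show ?case
    by (intro exI[of _ "p * q"] exI[of _ "k + l"]) (simp add: f g power_add algebra_simps)
qed

lemma continuous_on_circle_bounded:
  fixes f :: "complex \<Rightarrow> 'b::real_normed_vector"
  assumes "continuous_on (sphere 0 1) f"
  obtains B where "\<And>z. z \<in> sphere 0 1 \<Longrightarrow> norm (f z) \<le> B"
proof -
  have "compact (f ` sphere 0 1)"
    by (rule compact_continuous_image[OF assms]) simp
  then have "bounded (f ` sphere 0 1)" by (rule compact_imp_bounded)
  then obtain B where "\<forall>x\<in>f ` sphere 0 1. norm x \<le> B" unfolding bounded_iff by blast
  then show ?thesis by (intro that[of B]) blast
qed

section \<open>Support and null sets of a measure on the circle\<close>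

locale nontrivial_circle_measure =
  fixes \<mu> :: "complex measure"
  assumes circle: "circle_measure \<mu>" and nontrivial: "nontrivial \<mu>"
begin

sublocale finite_measure \<mu>
  using circle by (simp add: circle_measure_def)

lemma sets_eq: "sets \<mu> = sets (restrict_space borel (sphere (0::complex) 1))"
  using circle by (simp add: circle_measure_def)

lemma space_eq: "space \<mu> = sphere 0 1"
  using sets_eq_imp_space_eq[OF sets_eq] by (simp add: space_restrict_space)

lemma open_Int_space_sets: "open U \<Longrightarrow> U \<inter> space \<mu> \<in> sets \<mu>"
  unfolding sets_eq space_eq by (subst sets_restrict_space) (auto simp: image_iff)

lemma integrable_continuous:
  fixes f :: "complex \<Rightarrow> 'b::{banach,second_countable_topology}"
  assumes "continuous_on (sphere 0 1) f"
  shows "integrable \<mu> f"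
proof -
  have m: "f \<in> borel_measurable \<mu>"
    using borel_measurable_continuous_on_restrict[OF assms]
    by (simp add: measurable_cong_sets[OF sets_eq refl])
  obtain B where "\<And>z. z \<in> sphere 0 1 \<Longrightarrow> norm (f z) \<le> B"
    using continuous_on_circle_bounded[OF assms] by metis
  then show ?thesis
    by (intro integrable_const_bound[of _ B] AE_I2 m) (simp add: space_eq)
qed

text \<open>By continuity \<open>h \<noteq> 0\<close> defines a relatively open set. It is null, so
  it contains no point of the support.\<close>

lemma AE_eq_0_imp_supp:
  assumes "AE z in \<mu>. h z = 0" and "continuous_on (sphere 0 1) (h :: complex \<Rightarrow> real)"
    and "z \<in> supp \<mu>"
  shows "h z = 0"
proof (rule ccontr)
  assume nz: "h z \<noteq> 0"
  have "openin (top_of_set (sphere 0 1)) (sphere 0 1 \<inter> h -` (- {0}))"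
    by (rule continuous_openin_preimage_gen[OF assms(2)]) auto
  then obtain U where U: "open U" "sphere 0 1 \<inter> h -` (- {0}) = sphere 0 1 \<inter> U"
    unfolding openin_open by blast
  then have memU: "x \<in> U \<longleftrightarrow> h x \<noteq> 0" if "x \<in> sphere 0 1" for x
    using that by blast
  have "AE z in \<mu>. z \<notin> U \<inter> space \<mu>"
    using assms(1)
  proof (rule AE_mp, intro AE_I2 impI)
    fix x assume "x \<in> space \<mu>" "h x = 0"
    then show "x \<notin> U \<inter> space \<mu>" using memU by (auto simp: space_eq)
  qed
  then have "emeasure \<mu> (U \<inter> space \<mu>) = 0"
    by (subst (asm) AE_iff_measurable[OF open_Int_space_sets[OF U(1)]]) auto
  moreover have "z \<in> U" using assms(3) nz memU by (auto simp: supp_def space_eq)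
  ultimately show False using assms(3) U(1) unfolding supp_def by (metis (mono_tags, lifting) mem_Collect_eq less_irrefl)
qed

text \<open>The complement of the support is a union of null relatively open sets, and by Lindelof
  countably many of them suffice.\<close>

lemma AE_supp: "AE z in \<mu>. z \<in> supp \<mu>"
proof -
  let ?F = "{U. open U \<and> emeasure \<mu> (U \<inter> space \<mu>) = 0}"
  obtain G where G: "G \<subseteq> ?F" "countable G" "\<Union>G = \<Union>?F"
    using Lindelof[of ?F] by auto
  have "AE z in \<mu>. \<forall>U\<in>G. z \<notin> U"
  proof (subst AE_ball_countable[OF G(2)], intro ballI)
    fix U assume "U \<in> G"
    then have U: "open U" "emeasure \<mu> (U \<inter> space \<mu>) = 0" using G(1) by auto
    show "AE z in \<mu>. z \<notin> U"
      by (rule AE_I[of _ _ "U \<inter> space \<mu>"]) (use U open_Int_space_sets in auto)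
  qed
  then show ?thesis
  proof (rule AE_mp, intro AE_I2 impI)
    fix z assume "z \<in> space \<mu>" "\<forall>U\<in>G. z \<notin> U"
    then have "\<forall>U\<in>?F. z \<notin> U" using G(3) by blast
    with \<open>z \<in> space \<mu>\<close> show "z \<in> supp \<mu>"
      by (auto simp: supp_def zero_less_iff_neq_zero)
  qed
qed

text \<open>For \<open>p \<noteq> 0\<close> the support would lie among the finitely many zeros of
  \<open>h\<close> and \<open>p\<close>, but it is infinite.\<close>

lemma AE_poly_eq_0_imp:
  assumes "AE z in \<mu>. h z * cmod (poly p z) ^ 2 = 0"
    and "continuous_on (sphere 0 1) h" and "finite {z\<in>sphere 0 1. h z = 0}"
  shows "p = 0"
proof (rule ccontr)
  assume "p \<noteq> 0"
  have "supp \<mu> \<subseteq> {z\<in>sphere 0 1. h z = 0} \<union> {z. poly p z = 0}"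
  proof
    fix z assume z: "z \<in> supp \<mu>"
    have "h z * cmod (poly p z) ^ 2 = 0"
      by (rule AE_eq_0_imp_supp[OF assms(1) _ z]) (intro continuous_intros assms(2))
    then show "z \<in> {z\<in>sphere 0 1. h z = 0} \<union> {z. poly p z = 0}"
      using z by (auto simp: supp_def space_eq)
  qed
  moreover have "finite {z. poly p z = 0}" using \<open>p \<noteq> 0\<close> by (rule poly_roots_finite)
  ultimately show False
    using nontrivial assms(3) by (meson finite_UnI finite_subset nontrivial_def)
qed

section \<open>Hermitian forms on polynomials with a possibly signed weight\<close>

definition form :: "(complex \<Rightarrow> real) \<Rightarrow> complex poly \<Rightarrow> complex poly \<Rightarrow> complex" where
  "form s p q = (LINT z|\<mu>. of_real (s z) * poly p z * cnj (poly q z))"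

lemma form_zero [simp]: "form s 0 q = 0" "form s p 0 = 0"
  by (simp_all add: form_def)

lemma form_smult [simp]: "form s (smult c p) q = c * form s p q" "form s p (smult c q) = cnj c * form s p q"
  unfolding form_def by (simp_all add: mult.assoc mult.left_commute[of _ c] mult.left_commute[of _ "cnj c"])

lemma form_cnj: "form s q p = cnj (form s p q)"
proof -
  have "form s q p = (LINT z|\<mu>. cnj (of_real (s z) * poly p z * cnj (poly q z)))"
    by (simp add: form_def mult.commute mult.left_commute)
  also have "\<dots> = cnj (form s p q)" unfolding form_def by (rule Bochner_Integration.integral_cnj)
  finally show ?thesis .
qed

lemma integrable_form:
  assumes "continuous_on (sphere 0 1) s"
  shows "integrable \<mu> (\<lambda>z. of_real (s z) * poly p z * cnj (poly q z))"
  by (intro integrable_continuous continuous_intros assms)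

lemma form_add:
  assumes "continuous_on (sphere 0 1) s"
  shows "form s (p + q) r = form s p r + form s q r"
    and "form s r (p + q) = form s r p + form s r q"
    and "form s (p - q) r = form s p r - form s q r"
    and "form s r (p - q) = form s r p - form s r q"
proof -
  note int = integrable_form[OF assms]
  show "form s (p + q) r = form s p r + form s q r"
    unfolding form_def by (subst Bochner_Integration.integral_add[OF int int, symmetric]) (simp add: algebra_simps)
  show "form s r (p + q) = form s r p + form s r q"
    unfolding form_def by (subst Bochner_Integration.integral_add[OF int int, symmetric]) (simp add: algebra_simps)
  show "form s (p - q) r = form s p r - form s q r"
    unfolding form_def by (subst Bochner_Integration.integral_diff[OF int int, symmetric]) (simp add: algebra_simps)
  show "form s r (p - q) = form s r p - form s r q"
    unfolding form_def by (subst Bochner_Integration.integral_diff[OF int int, symmetric]) (simp add: algebra_simps)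
qed

lemma form_self: "form s p p = of_real (LINT z|\<mu>. s z * cmod (poly p z) ^ 2)"
  unfolding form_def
  by (subst integral_complex_of_real[symmetric])
     (simp add: complex_norm_square[symmetric] mult.assoc)

lemma integrable_form_self:
  assumes "continuous_on (sphere 0 1) s"
  shows "integrable \<mu> (\<lambda>z. s z * cmod (poly p z) ^ 2)"
  by (intro integrable_continuous continuous_intros assms)

text \<open>A vanishing integral of an almost everywhere nonnegative function would make
  \<open>s * |p|^2\<close> vanish almost everywhere, hence \<open>p = 0\<close>.\<close>

lemma form_pos:
  assumes s: "continuous_on (sphere 0 1) s" "finite {z\<in>sphere 0 1. s z = 0}"
    and nonneg: "\<And>z. z \<in> supp \<mu> \<Longrightarrow> 0 \<le> s z" and "p \<noteq> 0"
  shows "0 < Re (form s p p)"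
proof -
  have ae: "AE z in \<mu>. 0 \<le> s z * cmod (poly p z) ^ 2"
    using AE_supp by eventually_elim (simp add: nonneg)
  have "(LINT z|\<mu>. s z * cmod (poly p z) ^ 2) \<noteq> 0"
    using integral_nonneg_eq_0_iff_AE[OF integrable_form_self[OF s(1)] ae] 
      AE_poly_eq_0_imp[OF _ s, of p] \<open>p \<noteq> 0\<close> by auto
  moreover have "0 \<le> (LINT z|\<mu>. s z * cmod (poly p z) ^ 2)"
    by (rule integral_nonneg_AE[OF ae])
  ultimately show ?thesis by (simp add: form_self)
qed

text \<open>A continuous \<open>f \<ge> 0\<close> is a uniform limit of \<open>|p|\<^sup>2\<close>, by approximating its square root with
  Laurent polynomials; applied to the negative part of \<open>s\<close>.\<close>

lemma form_nonneg_imp: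
  assumes s: "continuous_on (sphere 0 1) s"
    and nonneg: "\<And>p. 0 \<le> Re (form s p p)" and z: "z \<in> supp \<mu>"
  shows "0 \<le> s z"
proof -
  define f where "f z = max 0 (- s z)" for z
  have cf: "continuous_on (sphere 0 1) f" unfolding f_def by (intro continuous_intros s)
  have "0 \<le> (LINT z|\<mu>. s z * f z)"
  proof (rule ccontr)
    assume neg: "\<not> ?thesis"
    have csf: "continuous_on (sphere 0 1) (\<lambda>z. sqrt (f z))" by (intro continuous_intros cf)
    obtain A where A: "\<And>z. z \<in> sphere 0 1 \<Longrightarrow> \<bar>s z\<bar> \<le> A"
      using continuous_on_circle_bounded[OF s] by (metis real_norm_def)
    obtain C where C: "\<And>z. z \<in> sphere 0 1 \<Longrightarrow> \<bar>sqrt (f z)\<bar> \<le> C"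
      using continuous_on_circle_bounded[OF csf] by (metis real_norm_def)
    have A0: "0 \<le> A" "0 \<le> C" using A[of 1] C[of 1] by auto
    \<comment> \<open>\<open>A * (2 * C + 1)\<close> bounds the pointwise error per unit of
      \<open>e\<close>; the extra 1 makes the total error strictly less than
      \<open>e * K\<close>.\<close>
    define K where "K = A * (2 * C + 1) * measure \<mu> (space \<mu>) + 1"
    have K: "K > 0" unfolding K_def by (intro add_nonneg_pos mult_nonneg_nonneg) (use A0 in auto)
    define e where "e = min 1 (- (LINT z|\<mu>. s z * f z) / K)"
    have e: "e > 0" "e \<le> 1" "e * K \<le> - (LINT z|\<mu>. s z * f z)"
      using neg K by (auto simp: e_def min_def field_simps)
    obtain g where g: "real_polynomial_function g"
        "\<And>z. z \<in> sphere 0 1 \<Longrightarrow> \<bar>sqrt (f z) - g z\<bar> < e"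
      using Stone_Weierstrass_real_polynomial_function[OF _ csf e(1)] by auto
    obtain q k where q: "\<And>z. z \<in> sphere 0 1 \<Longrightarrow> complex_of_real (g z) = poly q z * cnj z ^ k"
      using real_polynomial_on_circle[OF g(1)] by blast
    have sq: "cmod (poly q z) ^ 2 = g z ^ 2" if "z \<in> sphere 0 1" for z
    proof -
      have "\<bar>g z\<bar> = cmod (complex_of_real (g z))" by simp
      also have "\<dots> = cmod (poly q z)" unfolding q[OF that] using that by (simp add: norm_mult norm_power)
      finally show ?thesis by (metis power2_abs)
    qed
    \<comment> \<open>Factor \<open>g^2 - f = (g - sqrt f) * (g + sqrt f)\<close>; the cap
      \<open>e \<le> 1\<close> gives \<open>|g| \<le> C + 1\<close>.\<close>
    have d: "\<bar>s z * cmod (poly q z) ^ 2 - s z * f z\<bar> \<le> A * (2 * C + 1) * e" if z: "z \<in> sphere 0 1" for z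
    proof -
      have f0: "0 \<le> f z" by (simp add: f_def)
      have "\<bar>g z ^ 2 - f z\<bar> = \<bar>g z - sqrt (f z)\<bar> * \<bar>g z + sqrt (f z)\<bar>"
        using f0 by (simp add: abs_mult[symmetric] algebra_simps power2_eq_square)
      also have "\<dots> \<le> e * (2 * C + 1)"
        by (intro mult_mono) (use g(2)[OF z] C[OF z] e in auto)
      finally have "\<bar>s z\<bar> * \<bar>g z ^ 2 - f z\<bar> \<le> A * (e * (2 * C + 1))"
        by (intro mult_mono A z) (use A0 in auto)
      then show ?thesis
        unfolding sq[OF z] by (simp add: abs_mult[symmetric] algebra_simps)
    qed
    have int: "integrable \<mu> (\<lambda>z. s z * f z)"
      by (intro integrable_continuous continuous_intros s cf)
    have "\<bar>(LINT z|\<mu>. s z * cmod (poly q z) ^ 2) - (LINT z|\<mu>. s z * f z)\<bar>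
        = \<bar>LINT z|\<mu>. s z * cmod (poly q z) ^ 2 - s z * f z\<bar>"
      by (simp add: int integrable_form_self[OF s])
    also have "\<dots> \<le> (LINT z|\<mu>. \<bar>s z * cmod (poly q z) ^ 2 - s z * f z\<bar>)"
      by (rule integral_abs_bound)
    also have "\<dots> \<le> (LINT z|\<mu>. A * (2 * C + 1) * e)"
    proof (rule integral_mono)
      show "integrable \<mu> (\<lambda>z. \<bar>s z * cmod (poly q z) ^ 2 - s z * f z\<bar>)"
        by (intro integrable_abs Bochner_Integration.integrable_diff int integrable_form_self[OF s])
    qed (use d in \<open>auto simp: space_eq\<close>)
    also have "\<dots> < e * K" using e(1) by (simp add: K_def algebra_simps)
    finally have "(LINT z|\<mu>. s z * cmod (poly q z) ^ 2) < 0" using e(3) by linarith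
    then show False using nonneg[of q] by (simp add: form_self)
  qed
  \<comment> \<open>\<open>f\<close> is \<open>- s\<close> where \<open>s\<close> is negative and 0
    elsewhere, so nonnegativity of the integral of \<open>s * f\<close> forces \<open>f\<close> to
    vanish almost everywhere.\<close>
  moreover have "s z * f z = - (f z ^ 2)" for z by (simp add: f_def max_def power2_eq_square)
  ultimately have "(LINT z|\<mu>. f z ^ 2) \<le> 0" by simp
  moreover have "0 \<le> (LINT z|\<mu>. f z ^ 2)" by simp
  ultimately have "(LINT z|\<mu>. f z ^ 2) = 0" by linarith
  moreover have "integrable \<mu> (\<lambda>z. f z ^ 2)" by (intro integrable_continuous continuous_intros cf)
  ultimately have "AE z in \<mu>. f z ^ 2 = 0" by (subst (asm) integral_nonneg_eq_0_iff_AE) auto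
  then have "f z ^ 2 = 0" by (rule AE_eq_0_imp_supp[OF _ _ z]) (intro continuous_intros cf)
  then show ?thesis by (auto simp: f_def max_def split: if_splits)
qed

end

section \<open>Orthogonal polynomials and the Szego recurrence\<close>

locale circle_orthogonal_polys = nontrivial_circle_measure +
  fixes \<Phi> :: "nat \<Rightarrow> complex poly" and \<alpha> :: "nat \<Rightarrow> complex"
  assumes monic_orthogonal: "monic_orthogonal_polys \<mu> \<Phi>"
    and verblunsky: "\<alpha> n = - cnj (poly (\<Phi> (Suc n)) 0)"
begin

abbreviation ip :: "complex poly \<Rightarrow> complex poly \<Rightarrow> complex" where
  "ip \<equiv> form (\<lambda>_. 1)"

lemma degree_Phi [simp]: "degree (\<Phi> n) = n"
  and coeff_Phi [simp]: "coeff (\<Phi> n) n = 1"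
proof -
  have *: "\<forall>n. degree (\<Phi> n) = n \<and> lead_coeff (\<Phi> n) = 1"
    using monic_orthogonal unfolding monic_orthogonal_polys_def by blast
  then show d: "degree (\<Phi> n) = n" by blast
  have "lead_coeff (\<Phi> n) = 1" using * by blast
  then show "coeff (\<Phi> n) n = 1" unfolding d .
qed

lemma Phi_0: "\<Phi> 0 = 1"
  using degree_Phi[of 0] coeff_Phi[of 0] by (metis degree_eq_zeroE coeff_pCons_0 one_pCons)

lemma Phi_nonzero [simp]: "\<Phi> n \<noteq> 0"
  using coeff_Phi[of n] by (metis coeff_0 zero_neq_one)

lemma ip_Phi_Phi: "m \<noteq> n \<Longrightarrow> ip (\<Phi> n) (\<Phi> m) = 0"
  using monic_orthogonal by (auto simp: monic_orthogonal_polys_def form_def)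

lemmas ip_linear = form_add[of "\<lambda>_. 1", OF continuous_on_const]

lemma ip_eq_0_imp: "ip p p = 0 \<Longrightarrow> p = 0"
  using form_pos[of "\<lambda>_. 1" p] by fastforce

lemma ip_cong:
  assumes "\<And>z. z \<in> sphere 0 1 \<Longrightarrow> poly p z * cnj (poly q z) = poly p' z * cnj (poly q' z)"
  shows "ip p q = ip p' q'"
  unfolding form_def by (rule Bochner_Integration.integral_cong) (use assms in \<open>auto simp: space_eq\<close>)

lemma ip_shift: "ip (pCons 0 p) (pCons 0 q) = ip p q"
proof (rule ip_cong)
  fix z :: complex assume "z \<in> sphere 0 1"
  then have "z * cnj z = 1" by (rule sphere_cnj_mult)
  then show "poly (pCons 0 p) z * cnj (poly (pCons 0 q) z) = poly p z * cnj (poly q z)"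
    by (simp add: algebra_simps)
qed

lemma ip_Phi_low: "\<forall>k\<ge>n. coeff q k = 0 \<Longrightarrow> ip (\<Phi> n) q = 0"
  by (rule monic_basis_induct[where P = \<Phi> and n = n]) (auto simp: ip_linear ip_Phi_Phi)

definition sqnorm :: "nat \<Rightarrow> real" where
  "sqnorm n = Re (ip (\<Phi> n) (\<Phi> n))"

lemma sqnorm_pos: "0 < sqnorm n"
  unfolding sqnorm_def by (rule form_pos) auto

lemma ip_Phi_self: "ip (\<Phi> n) (\<Phi> n) = of_real (sqnorm n)"
  unfolding sqnorm_def form_self by simp

text \<open>The reversed polynomial \<open>z^n * cnj (\<Phi> n (1 / cnj z))\<close>;
  \<open>reflect_poly\<close> reverses at the actual degree, which is \<open>n\<close> here.\<close>

definition Phi_star :: "nat \<Rightarrow> complex poly" where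
  "Phi_star n = reflect_poly (map_poly cnj (\<Phi> n))"

lemma degree_cnj_Phi [simp]: "degree (map_poly cnj (\<Phi> n)) = n"
  by (simp add: degree_map_poly)

lemma coeff_star_0 [simp]: "coeff (Phi_star n) 0 = 1"
  unfolding Phi_star_def by (simp add: coeff_map_poly)

lemma coeff_star_gt [simp]: "n < k \<Longrightarrow> coeff (Phi_star n) k = 0"
  unfolding Phi_star_def by (simp add: coeff_reflect_poly)

lemma poly_star:
  assumes "z \<in> sphere 0 1"
  shows "poly (Phi_star n) z = z ^ n * cnj (poly (\<Phi> n) z)"
proof -
  have "inverse z = cnj z" by (rule inverse_unique) (rule sphere_cnj_mult[OF assms])
  moreover have "z \<noteq> 0" using assms by auto
  ultimately show ?thesis unfolding Phi_star_def by (simp add: poly_reflect_poly_nz)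
qed

text \<open>On the circle, pairing \<open>Phi_star n\<close> with \<open>z^(j+1)\<close> is the same
  as pairing \<open>z^(n-j-1)\<close> with \<open>\<Phi> n\<close>, which gives 0 for
  \<open>j < n\<close>.\<close>

lemma ip_star_low:
  assumes "\<forall>k\<ge>n. coeff q k = 0"
  shows "ip (Phi_star n) (pCons 0 q) = 0"
proof (rule monic_basis_induct[where P = "monom 1" and n = n, OF _ _ _ _ assms])
  fix r c j assume j: "j < n" and r: "ip (Phi_star n) (pCons 0 r) = 0"
  have "ip (Phi_star n) (monom 1 (Suc j)) = ip (monom 1 (n - Suc j)) (\<Phi> n)"
  proof (rule ip_cong)
    fix z :: complex assume z: "z \<in> sphere 0 1"
    have "z ^ n * cnj z ^ Suc j = z ^ (n - Suc j) * (z * cnj z) ^ Suc j"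
      using j by (simp only: power_mult_distrib mult.assoc[symmetric] power_add[symmetric]) simp
    then have "z ^ n * cnj z ^ Suc j = z ^ (n - Suc j)" by (simp add: sphere_cnj_mult[OF z])
    then show "poly (Phi_star n) z * cnj (poly (monom 1 (Suc j)) z)
        = poly (monom 1 (n - Suc j)) z * cnj (poly (\<Phi> n) z)"
      by (simp add: poly_star[OF z] poly_monom mult_ac)
  qed
  also have "\<dots> = cnj (ip (\<Phi> n) (monom 1 (n - Suc j)))" by (rule form_cnj)
  also have "ip (\<Phi> n) (monom 1 (n - Suc j)) = 0" using j by (intro ip_Phi_low) auto
  finally have "ip (Phi_star n) (monom 1 (Suc j)) = 0" by simp
  moreover have "pCons 0 (r + smult c (monom 1 j)) = pCons 0 r + smult c (monom 1 (Suc j))"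
    by (simp add: monom_Suc)
  ultimately show "ip (Phi_star n) (pCons 0 (r + smult c (monom 1 j))) = 0"
    using r by (simp only: ip_linear form_smult mult_zero_right add_0)
qed (auto simp: degree_monom_eq)

text \<open>The difference \<open>f\<close> of the two sides has no constant term, by the definition
  of \<open>\<alpha> n\<close>, and its terms of degree \<open>n + 1\<close> cancel. So
  \<open>f = z * g\<close> with \<open>g\<close> of degree below \<open>n\<close>, and all three
  terms of \<open>f\<close> are orthogonal to \<open>z * g\<close>; thus \<open>f\<close> is
  orthogonal to itself.\<close>

lemma szego_recurrence: "\<Phi> (Suc n) = pCons 0 (\<Phi> n) - smult (cnj (\<alpha> n)) (Phi_star n)"
proof -
  define f where "f = \<Phi> (Suc n) - pCons 0 (\<Phi> n) + smult (cnj (\<alpha> n)) (Phi_star n)"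
  obtain c g where f: "f = pCons c g" by (cases f)
  have "coeff f 0 = 0" by (simp add: f_def verblunsky poly_0_coeff_0)
  then have c: "c = 0" by (simp add: f)
  have gf: "coeff g k = coeff f (Suc k)" for k by (simp add: f)
  have g: "\<forall>k\<ge>n. coeff g k = 0"
  proof (intro allI impI)
    fix k assume "n \<le> k"
    then show "coeff g k = 0" unfolding gf
      by (cases "k = n") (simp_all add: f_def coeff_eq_0)
  qed
  have 1: "ip (\<Phi> (Suc n)) (pCons 0 g) = 0"
    by (rule ip_Phi_low) (use g in \<open>auto simp: coeff_pCons split: nat.split\<close>)
  have "ip f f = ip f (pCons 0 g)" by (simp only: f c)
  also have "\<dots> = ip (\<Phi> (Suc n)) (pCons 0 g) - ip (pCons 0 (\<Phi> n)) (pCons 0 g)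
      + cnj (\<alpha> n) * ip (Phi_star n) (pCons 0 g)"
    unfolding f_def by (simp only: ip_linear form_smult)
  also have "\<dots> = 0" using 1 ip_Phi_low[OF g] ip_star_low[OF g] by (simp add: ip_shift)
  finally have "f = 0" by (rule ip_eq_0_imp)
  then show ?thesis unfolding f_def by (simp add: algebra_simps)
qed

lemma poly_Phi_Suc: "poly (\<Phi> (Suc n)) z = z * poly (\<Phi> n) z - cnj (\<alpha> n) * poly (Phi_star n) z"
  by (simp add: szego_recurrence)

text \<open>The conjugate of the Szego recurrence, multiplied by \<open>z^(n+1)\<close>.\<close>

lemma poly_star_Suc:
  assumes z: "z \<in> sphere 0 1"
  shows "poly (Phi_star (Suc n)) z = poly (Phi_star n) z - \<alpha> n * z * poly (\<Phi> n) z"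
proof -
  have e: "z ^ n * cnj z ^ n = 1"
    using sphere_cnj_mult[OF z] by (simp flip: power_mult_distrib)
  have "poly (Phi_star (Suc n)) z = (z * cnj z) * (z ^ n * cnj (poly (\<Phi> n) z))
     - \<alpha> n * z * ((z ^ n * cnj z ^ n) * poly (\<Phi> n) z)"
    unfolding poly_star[OF z] poly_Phi_Suc by (simp add: algebra_simps)
  then show ?thesis unfolding e sphere_cnj_mult[OF z] by (simp add: poly_star[OF z])
qed

lemma ip_star_self: "ip (Phi_star n) (Phi_star n) = of_real (sqnorm n)"
proof -
  have "ip (Phi_star n) (Phi_star n) = ip (\<Phi> n) (\<Phi> n)"
  proof (rule ip_cong)
    fix z :: complex assume z: "z \<in> sphere 0 1"
    have e: "z ^ n * cnj z ^ n = 1"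
      using sphere_cnj_mult[OF z] by (simp flip: power_mult_distrib)
    have "poly (Phi_star n) z * cnj (poly (Phi_star n) z)
      = (z ^ n * cnj z ^ n) * (poly (\<Phi> n) z * cnj (poly (\<Phi> n) z))"
      unfolding poly_star[OF z] by (simp add: algebra_simps)
    then show "poly (Phi_star n) z * cnj (poly (Phi_star n) z) = poly (\<Phi> n) z * cnj (poly (\<Phi> n) z)"
      unfolding e by simp
  qed
  then show ?thesis by (simp add: ip_Phi_self)
qed

lemma pCons_Phi: "pCons 0 (\<Phi> n) = \<Phi> (Suc n) + smult (cnj (\<alpha> n)) (Phi_star n)"
  by (simp add: szego_recurrence)

lemma ip_Phi_Suc_star: "ip (\<Phi> (Suc n)) (Phi_star n) = 0" "ip (Phi_star n) (\<Phi> (Suc n)) = 0"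
proof -
  show "ip (\<Phi> (Suc n)) (Phi_star n) = 0" by (rule ip_Phi_low) auto
  then show "ip (Phi_star n) (\<Phi> (Suc n)) = 0" by (subst form_cnj) simp
qed

lemma ip_star_shift: "ip (Phi_star n) (pCons 0 (\<Phi> n)) = \<alpha> n * of_real (sqnorm n)"
  unfolding pCons_Phi by (simp add: ip_linear ip_Phi_Suc_star ip_star_self)

text \<open>Multiplication by \<open>z\<close> is isometric and \<open>\<Phi> (Suc n)\<close> is
  orthogonal to \<open>Phi_star n\<close>, so Pythagoras gives
  \<open>sqnorm n = sqnorm (Suc n) + |\<alpha> n|^2 * sqnorm n\<close>.\<close>

lemma norm_verblunsky: "cmod (\<alpha> n) < 1"
proof -
  have "ip (pCons 0 (\<Phi> n)) (pCons 0 (\<Phi> n))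
      = of_real (sqnorm (Suc n)) + \<alpha> n * cnj (\<alpha> n) * of_real (sqnorm n)"
    unfolding pCons_Phi by (simp add: ip_linear ip_Phi_Suc_star ip_star_self ip_Phi_self algebra_simps)
  then have "complex_of_real (sqnorm n) = of_real (sqnorm (Suc n) + (cmod (\<alpha> n))\<^sup>2 * sqnorm n)"
    by (simp only: ip_shift ip_Phi_self complex_norm_square[symmetric] of_real_add of_real_mult)
  then have "sqnorm n = sqnorm (Suc n) + (cmod (\<alpha> n))\<^sup>2 * sqnorm n"
    by (simp only: of_real_eq_iff)
  then have "(cmod (\<alpha> n))\<^sup>2 * sqnorm n < 1 * sqnorm n" using sqnorm_pos[of "Suc n"] by linarith
  then have "(cmod (\<alpha> n))\<^sup>2 < 1" using sqnorm_pos[of n] by (simp only: mult_less_cancel_right)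
  then show ?thesis by (simp add: power2_less_1_iff)
qed

section \<open>The unimodular sequence \<open>\<tau>\<close> and the polynomials
  \<open>S n\<close>\<close>

context
  fixes \<theta> :: real
begin

abbreviation \<tau> :: "nat \<Rightarrow> complex" where "\<tau> \<equiv> tau \<alpha> \<theta>"

abbreviation a :: "nat \<Rightarrow> complex" where "a n \<equiv> \<tau> n * \<alpha> n"

lemma norm_tau: "cmod (\<tau> n) = 1"
  and norm_a: "cmod (a n) < 1"
proof -
  have *: "cmod (\<tau> n) = 1 \<Longrightarrow> cmod (a n) < 1" for n
    using norm_verblunsky[of n] by (simp add: norm_mult)
  show **: "cmod (\<tau> n) = 1" for n
  proof (induction n)
    case (Suc n)
    have "1 - a n \<noteq> 0" using *[OF Suc] by auto
    moreover have "cmod (1 - cnj (a n)) = cmod (1 - a n)"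
      by (metis complex_cnj_diff complex_cnj_one complex_mod_cnj)
    ultimately show ?case using Suc by (simp add: norm_mult norm_divide)
  qed simp
  show "cmod (a n) < 1" using * ** .
qed

lemma one_minus_a: "1 - a n \<noteq> 0" "1 - cnj (a n) \<noteq> 0" "Re (a n) < 1"
proof -
  show "1 - a n \<noteq> 0" using norm_a[of n] by auto
  then show "1 - cnj (a n) \<noteq> 0" by (metis complex_cnj_cancel_iff complex_cnj_diff complex_cnj_one complex_cnj_zero_iff)
  show "Re (a n) < 1" using norm_a[of n] complex_Re_le_cmod[of "a n"] by linarith
qed

lemma tau_cnj: "\<tau> n * cnj (\<tau> n) = 1"
  using sphere_cnj_mult(1)[of "\<tau> n"] norm_tau by simp

lemma tau_Suc: "\<tau> (Suc n) * (1 - a n) = cis \<theta> * (\<tau> n * (1 - cnj (a n)))"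
  using one_minus_a(1)[of n] by simp

lemma tau_Suc': "\<tau> (Suc n) * (1 - a n) = cis \<theta> * (\<tau> n - cnj (\<alpha> n))"
proof -
  have "\<tau> n * (1 - cnj (a n)) = \<tau> n - (\<tau> n * cnj (\<tau> n)) * cnj (\<alpha> n)" by (simp add: algebra_simps)
  then show ?thesis unfolding tau_Suc tau_cnj by simp
qed

text \<open>Identifies \<open>\<tau> n\<close> as the ratio of \<open>w * \<Phi> n (w)\<close> to
  \<open>Phi_star n (w)\<close> at \<open>w = cis \<theta>\<close>, in product form to avoid
  division. The Szego recurrences for numerator and denominator reproduce the recursion of
  \<open>tau\<close>.\<close>

lemma tau_eq: "\<tau> n * poly (Phi_star n) (cis \<theta>) = cis \<theta> * poly (\<Phi> n) (cis \<theta>)"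
proof (induction n)
  case 0
  show ?case by (subst poly_star) (auto simp: Phi_0)
next
  case (Suc n)
  have "\<tau> (Suc n) * poly (Phi_star (Suc n)) (cis \<theta>)
      = \<tau> (Suc n) * (poly (Phi_star n) (cis \<theta>) - \<alpha> n * (cis \<theta> * poly (\<Phi> n) (cis \<theta>)))"
    by (subst poly_star_Suc) auto
  also have "\<dots> = \<tau> (Suc n) * (1 - a n) * poly (Phi_star n) (cis \<theta>)"
    unfolding Suc[symmetric] by (simp only: algebra_simps mult_1)
  also have "\<dots> = cis \<theta> * (cis \<theta> * poly (\<Phi> n) (cis \<theta>) - cnj (\<alpha> n) * poly (Phi_star n) (cis \<theta>))"
    unfolding tau_Suc' Suc[symmetric] by (simp only: algebra_simps)
  finally show ?case unfolding poly_Phi_Suc .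
qed

text \<open>Up to a factor, \<open>S n\<close> is \<open>(1 - z * cnj w) * K\<^sub>n(z, w)\<close> with \<open>w = cis \<theta>\<close> and
  \<open>K\<^sub>n\<close> the Christoffel--Darboux kernel.\<close>

definition S :: "nat \<Rightarrow> complex poly" where
  "S n = Phi_star n - smult (cnj (\<tau> n)) (pCons 0 (\<Phi> n))"

lemma poly_S_cis [simp]: "poly (S n) (cis \<theta>) = 0"
proof -
  have "poly (S n) (cis \<theta>) = poly (Phi_star n) (cis \<theta>) - cnj (\<tau> n) * (cis \<theta> * poly (\<Phi> n) (cis \<theta>))"
    by (simp add: S_def)
  also have "\<dots> = poly (Phi_star n) (cis \<theta>) * (1 - \<tau> n * cnj (\<tau> n))"
    unfolding tau_eq[symmetric] by (simp add: algebra_simps)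
  finally show ?thesis by (simp add: tau_cnj)
qed

lemma coeff_S [simp]: "coeff (S n) (Suc n) = - cnj (\<tau> n)" "Suc n < k \<Longrightarrow> coeff (S n) k = 0"
proof -
  show "coeff (S n) (Suc n) = - cnj (\<tau> n)" by (simp add: S_def)
  assume "Suc n < k"
  then show "coeff (S n) k = 0" by (cases k) (auto simp: S_def coeff_eq_0)
qed

text \<open>Both terms of \<open>S n\<close> are orthogonal to \<open>z * r\<close> for
  \<open>r\<close> of degree below \<open>n\<close>, so only the top coefficient of \<open>q\<close>
  contributes.\<close>

lemma ip_S:
  assumes "\<forall>k>n. coeff q k = 0"
  shows "ip (S n) (pCons 0 q) = cnj (coeff q n) * of_real (sqnorm n) * (\<alpha> n - cnj (\<tau> n))"
proof -
  define r where "r = q - smult (coeff q n) (\<Phi> n)"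
  have r: "\<forall>k\<ge>n. coeff r k = 0"
  proof (intro allI impI)
    fix k assume "n \<le> k"
    then show "coeff r k = 0" using assms by (cases "k = n") (simp_all add: r_def coeff_eq_0)
  qed
  have "pCons 0 q = smult (coeff q n) (pCons 0 (\<Phi> n)) + pCons 0 r" by (simp add: r_def)
  then have "ip (S n) (pCons 0 q)
     = cnj (coeff q n) * ip (S n) (pCons 0 (\<Phi> n)) + ip (S n) (pCons 0 r)"
    by (simp only: ip_linear form_smult)
  moreover have "ip (S n) (pCons 0 r) = 0"
    unfolding S_def using ip_Phi_low[OF r] ip_star_low[OF r]
    by (simp only: ip_linear form_smult ip_shift) simp
  moreover have "ip (S n) (pCons 0 (\<Phi> n)) = of_real (sqnorm n) * (\<alpha> n - cnj (\<tau> n))"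
    unfolding S_def by (simp only: ip_linear form_smult ip_shift ip_star_shift ip_Phi_self algebra_simps)
  ultimately show ?thesis by simp
qed

text \<open>The auxiliary \<open>T n\<close> is another combination of \<open>Phi_star n\<close> and
  \<open>\<Phi> n\<close>. One Szego step expresses \<open>S (Suc n)\<close> by \<open>S n\<close>
  and \<open>T n\<close>, and \<open>T (Suc n)\<close> is a multiple of \<open>S n\<close> alone;
  eliminating \<open>T\<close> leaves a three-term recurrence.\<close>

lemma poly_S_rec:
  assumes z: "z \<in> sphere 0 1"
  defines "u \<equiv> z / cis \<theta>"
  shows "(1 - cnj (a 0)) * poly (S 1) z = ((1 - cnj (a 0)) + u * (1 - a 0)) * poly (S 0) z" (is ?A)
    and "(1 - cnj (a (Suc n))) * poly (S (Suc (Suc n))) z =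
      ((1 - cnj (a (Suc n))) + u * (1 - a (Suc n))) * poly (S (Suc n)) z
      - u * of_real ((cmod (1 - a (Suc n)))\<^sup>2) * (of_real (1 - (cmod (a n))\<^sup>2) / (1 - cnj (a n))) * poly (S n) z" (is ?B)
proof -
  define w where "w = cis \<theta>"
  define T where "T n = poly (Phi_star n) z - w * cnj (\<tau> n) * poly (\<Phi> n) z" for n
  have w: "w * cnj w = 1" using sphere_cnj_mult(1)[of w] by (simp add: w_def)
  then have u: "u * w = z" by (simp add: u_def w_def)
  have tc: "cnj (\<tau> (Suc n)) * (1 - cnj (a n)) = cnj w * (cnj (\<tau> n) - \<alpha> n)" for n
  proof -
    have "cnj (\<tau> (Suc n) * (1 - a n)) = cnj (w * (\<tau> n - cnj (\<alpha> n)))" by (simp only: tau_Suc' w_def)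
    then show ?thesis
      by (simp only: complex_cnj_mult complex_cnj_diff complex_cnj_cnj complex_cnj_one)
  qed
  have nsq: "of_real ((cmod x)\<^sup>2) = x * cnj x" for x by (rule complex_norm_square)
  have T: "(1 - cnj (a n)) * T (Suc n) = of_real (1 - (cmod (a n))\<^sup>2) * poly (S n) z" for n
  proof -
    have "(1 - cnj (a n)) * T (Suc n)
      = (1 - cnj (a n)) * (poly (Phi_star n) z - \<alpha> n * z * poly (\<Phi> n) z)
       - w * (cnj (\<tau> (Suc n)) * (1 - cnj (a n))) * (z * poly (\<Phi> n) z - cnj (\<alpha> n) * poly (Phi_star n) z)"
      unfolding T_def poly_star_Suc[OF z] poly_Phi_Suc by (simp only: algebra_simps)
    also have "\<dots> = (1 - cnj (a n)) * (poly (Phi_star n) z - \<alpha> n * z * poly (\<Phi> n) z)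
       - (w * cnj w) * ((cnj (\<tau> n) - \<alpha> n) * (z * poly (\<Phi> n) z - cnj (\<alpha> n) * poly (Phi_star n) z))"
      unfolding tc by (simp only: mult_ac)
    also have "\<dots> = (1 - \<alpha> n * cnj (\<alpha> n)) * (poly (Phi_star n) z - cnj (\<tau> n) * (z * poly (\<Phi> n) z))"
      unfolding w by (simp add: algebra_simps)
    also have "\<alpha> n * cnj (\<alpha> n) = of_real ((cmod (a n))\<^sup>2)"
      unfolding nsq[symmetric] by (simp add: norm_mult norm_tau)
    finally show ?thesis by (simp add: S_def)
  qed
  have *: "(1 - cnj (a n)) * poly (S (Suc n)) z
      = ((1 - cnj (a n)) + u * (1 - a n)) * poly (S n) z - u * of_real ((cmod (1 - a n))\<^sup>2) * T n" for n
  proof -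
    \<comment> \<open>With these atoms the claim is a polynomial identity modulo
      \<open>\<tau> n * t = 1\<close> and \<open>u * w = z\<close>.\<close>
    define t A R F where "t = cnj (\<tau> n)" "A = \<alpha> n" "R = poly (Phi_star n) z" "F = poly (\<Phi> n) z"
    have t: "\<tau> n * t = 1" by (simp add: t_A_R_F_def tau_cnj)
    have uz: "z * cnj w = u" using w by (simp add: u[symmetric] mult.assoc)
    have "(1 - cnj (a n)) * poly (S (Suc n)) z
      = (1 - cnj (a n)) * (R - A * z * F)
       - (cnj (\<tau> (Suc n)) * (1 - cnj (a n))) * (z * (z * F - cnj A * R))"
      unfolding t_A_R_F_def
      by (simp only: S_def poly_diff poly_smult poly_pCons poly_star_Suc[OF z] poly_Phi_Suc)
         (simp only: algebra_simps add_0)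
    also have "\<dots> = (1 - t * cnj A) * (R - A * z * F)
       - (z * cnj w) * ((t - A) * (z * F - cnj A * R))"
      unfolding tc
      by (simp only: t_A_R_F_def complex_cnj_mult complex_cnj_diff) (simp only: algebra_simps)
    also have "\<dots> = (1 - t * cnj A) * (R - A * z * F) - u * ((t - A) * (z * F - cnj A * R))"
      unfolding uz ..
    also have "\<dots> = ((1 - t * cnj A) + u * (1 - \<tau> n * A)) * (R - t * (z * F))
       - u * ((1 - \<tau> n * A) * (1 - t * cnj A)) * (R - w * t * F)"
      using t u by algebra
    finally show ?thesis unfolding nsq by (simp add: t_A_R_F_def S_def T_def)
  qed
  \<comment> \<open>\<open>T 0 = 1 - w * cnj w\<close>, so the first recurrence has no lower
    term.\<close>
  have "T 0 = 0" using w unfolding T_def poly_star[OF z] by (simp add: w_def Phi_0)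
  then show ?A using *[of 0] by simp
  have "T (Suc n) = of_real (1 - (cmod (a n))\<^sup>2) / (1 - cnj (a n)) * poly (S n) z"
    using T[of n] one_minus_a(2)[of n] by (simp add: field_simps)
  then show ?B using *[of "Suc n"] by (simp add: mult.assoc)
qed

end

end

section \<open>Chain sequences\<close>

text \<open>The solution that starts as if the value at index -1 were 0. \<open>y\<close> is read
  from index 1 and \<open>d\<close> from index 2, as for \<open>c_coef\<close> and
  \<open>d_coef\<close>.\<close>

fun three_term :: "(nat \<Rightarrow> real) \<Rightarrow> (nat \<Rightarrow> real) \<Rightarrow> nat \<Rightarrow> real" where
  "three_term y d 0 = 1"
| "three_term y d (Suc 0) = y 1"
| "three_term y d (Suc (Suc n)) =
     y (Suc (Suc n)) * three_term y d (Suc n) - d (Suc (Suc n)) * three_term y d n"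

text \<open>The minimal parameters satisfy \<open>1 - m n = r (n + 1) / (y (n + 1) * r n)\<close> for the solution \<open>r\<close>
  of the three term recurrence.\<close>

lemma chain_sequence_iff:
  fixes y d m :: "nat \<Rightarrow> real"
  assumes d: "\<And>n. 0 < d (Suc (Suc n))" and m0: "m 0 = 0"
    and m: "\<And>n. m (Suc n) = d (Suc (Suc n)) / (y (Suc n) * y (Suc (Suc n))) / (1 - m n)"
  defines "r \<equiv> three_term y d"
  shows "(y 1 < 0 \<and> (\<forall>n\<ge>1. (y n \<noteq> 0 \<and> y (n + 1) \<noteq> 0 \<and> 1 - m (n - 1) \<noteq> 0) \<and> 0 < m n \<and> m n < 1))
    \<longleftrightarrow> (\<forall>n. r (Suc n) / r n < 0)" (is "?L \<longleftrightarrow> ?R")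
proof -
  have r_simps: "r 0 = 1" "r (Suc 0) = y 1"
      "\<And>n. r (Suc (Suc n)) = y (Suc (Suc n)) * r (Suc n) - d (Suc (Suc n)) * r n"
    by (simp_all add: r_def)
  have step: "1 - m (Suc n) = r (Suc (Suc n)) / (y (Suc (Suc n)) * r (Suc n))"
    if "1 - m n = r (Suc n) / (y (Suc n) * r n)" "r n \<noteq> 0" "r (Suc n) \<noteq> 0" "y (Suc n) \<noteq> 0" "y (Suc (Suc n)) \<noteq> 0"
    for n
    unfolding m that(1) using that(2-) by (simp add: field_simps r_simps(3))
  show ?thesis
  proof
    assume L: ?L
    have "y (Suc n) < 0 \<and> r n \<noteq> 0 \<and> r (Suc n) / r n < 0 \<and> 1 - m n = r (Suc n) / (y (Suc n) * r n)" for n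
    proof (induction n)
      case 0
      then show ?case using L by (auto simp: r_simps m0)
    next
      case (Suc n)
      have mm: "0 < m (Suc n)" "m (Suc n) < 1" using L by auto
      have mn: "m n < 1"
      proof (cases n)
        case (Suc k) then show ?thesis using L by auto
      qed (simp add: m0)
      have ynz: "y (Suc (Suc n)) \<noteq> 0" using L[THEN conjunct2, rule_format, of "Suc n"] by simp
      have rn: "r (Suc n) \<noteq> 0" using Suc by auto
      \<comment> \<open>With \<open>d > 0\<close> and \<open>m n < 1\<close>, positivity of
        \<open>m (Suc n)\<close> forces consecutive \<open>y\<close> to have equal signs, so
        negativity spreads from \<open>y 1\<close>.\<close>
      have "0 < y (Suc n) * y (Suc (Suc n))"
        using mm(1) mn d[of n] unfolding m by (auto simp: zero_less_divide_iff zero_less_mult_iff)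
      then have y: "y (Suc (Suc n)) < 0" using Suc by (auto simp: zero_less_mult_iff)
      have e: "1 - m (Suc n) = r (Suc (Suc n)) / (y (Suc (Suc n)) * r (Suc n))"
        by (rule step) (use Suc rn ynz in auto)
      then have "r (Suc (Suc n)) / r (Suc n) = (1 - m (Suc n)) * y (Suc (Suc n))"
        using y rn by (simp add: field_simps)
      also have "\<dots> < 0" using y mm by (simp add: mult_pos_neg)
      finally show ?case using y rn e by blast
    qed
    then show ?R by blast
  next
    assume R: ?R
    have rnz: "r n \<noteq> 0" for n using R[rule_format, of n] by auto
    have "y (Suc n) < 0 \<and> 0 < 1 - m n \<and> 1 - m n = r (Suc n) / (y (Suc n) * r n)" for n
    proof (induction n)
      case 0
      then show ?case using R[rule_format, of 0] by (auto simp: r_simps m0)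
    next
      case (Suc n)
      \<comment> \<open>Solving the recurrence for \<open>y\<close> writes it as a sum of two
        negative terms.\<close>
      have "y (Suc (Suc n)) = r (Suc (Suc n)) / r (Suc n) + d (Suc (Suc n)) / (r (Suc n) / r n)"
        using rnz[of n] rnz[of "Suc n"] by (simp add: field_simps r_simps(3))
      also have "\<dots> < 0"
        using R[rule_format, of "Suc n"] divide_pos_neg[OF d[of n] R[rule_format, of n]] by (rule add_neg_neg)
      finally have y: "y (Suc (Suc n)) < 0" .
      have e: "1 - m (Suc n) = r (Suc (Suc n)) / (y (Suc (Suc n)) * r (Suc n))"
        by (rule step) (use Suc rnz y in auto)
      also have "\<dots> = (r (Suc (Suc n)) / r (Suc n)) / y (Suc (Suc n))" by simp
      also have "\<dots> > 0" using R y by (intro divide_neg_neg) auto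
      finally show ?case using y e by simp
    qed
    then have *: "y (Suc n) < 0" "m n < 1" for n by (auto simp: field_simps)
    have "0 < m (Suc n)" for n
      unfolding m using *[of n] *[of "Suc n"] d[of n] by (simp add: zero_less_divide_iff mult_neg_neg)
    show ?L
    proof (intro conjI allI impI)
      show "y 1 < 0" using *(1)[of 0] by simp
      fix n :: nat assume "1 \<le> n"
      then obtain k where n: "n = Suc k" by (cases n) auto
      show "y n \<noteq> 0" "y (n + 1) \<noteq> 0" "1 - m (n - 1) \<noteq> 0" "0 < m n" "m n < 1"
        using *[of k] *[of "Suc k"] \<open>0 < m (Suc k)\<close> by (simp_all add: n)
    qed
  qed
qed

section \<open>The quadratic form of an arc\<close>

lemma cis_diff_eq: "cis s - cis t = 2 * \<i> * of_real (sin ((s - t) / 2)) * cis ((s + t) / 2)"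
proof -
  have "2 * \<i> * of_real (sin x) = cis x - cis (- x)" for x by (simp add: complex_eq_iff)
  then have "2 * \<i> * of_real (sin ((s - t) / 2)) * cis ((s + t) / 2)
      = cis ((s - t) / 2) * cis ((s + t) / 2) - cis (- ((s - t) / 2)) * cis ((s + t) / 2)"
    by (simp only: left_diff_distrib)
  also have "\<dots> = cis s - cis t" unfolding cis_mult by (simp add: field_simps)
  finally show ?thesis ..
qed

text \<open>The free starting angle lets the parameter interval begin at the left end of the
  arc.\<close>

lemma circle_eq_cis:
  assumes "z \<in> sphere (0::complex) 1"
  obtains t where "\<theta> \<le> t" "t < \<theta> + 2 * pi" "z = cis t"
proof -
  define v where "v = z * cis (- \<theta>)"
  have v: "v = cis (Arg2pi v)"
    using Arg2pi_eq[of v] assms by (simp add: v_def norm_mult cis_conv_exp)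
  have "z = v * cis \<theta>" by (simp add: v_def mult.assoc cis_mult)
  also have "\<dots> = cis (\<theta> + Arg2pi v)" using v by (metis cis_mult mult.commute)
  finally show ?thesis
    using that[of "\<theta> + Arg2pi v"] Arg2pi_ge_0[of v] Arg2pi_lt_2pi[of v] by simp
qed

lemma two_roots_dvd:
  fixes p :: "complex poly"
  assumes "poly p a = 0" "poly p b = 0" "a \<noteq> b"
  obtains q where "p = [:- a, 1:] * [:- b, 1:] * q"
proof -
  obtain q where q: "p = [:- a, 1:] * q" using assms(1) by (metis poly_eq_0_iff_dvd dvdE)
  have "poly q b = 0" using assms(2,3) unfolding q by simp
  then obtain r where "q = [:- b, 1:] * r" by (metis poly_eq_0_iff_dvd dvdE)
  then show ?thesis using that q by (metis mult.assoc)
qed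

text \<open>The strict upper bound keeps the end points distinct; an arc of length
  \<open>2 * pi\<close> is treated separately.\<close>

locale circle_arc = circle_orthogonal_polys +
  fixes \<theta>1 \<theta>2 :: real
  assumes arc: "\<theta>1 < \<theta>2" "\<theta>2 - \<theta>1 < 2 * pi"
begin

abbreviation \<zeta> where "\<zeta> \<equiv> cis \<theta>1"
abbreviation w where "w \<equiv> cis \<theta>2"
abbreviation h where "h \<equiv> cis (half_angle \<theta>1 \<theta>2)"
abbreviation aa where "aa n \<equiv> tau \<alpha> \<theta>2 n * \<alpha> n"

text \<open>\<open>h\<close> is the square root of \<open>\<zeta> / w\<close> in the upper half
  plane; it makes the recurrence at \<open>\<zeta>\<close> real.\<close>

lemma h_sq: "h * h * w = \<zeta>"
proof -
  have "half_angle \<theta>1 \<theta>2 + half_angle \<theta>1 \<theta>2 + \<theta>2 = \<theta>1 + 2 * pi"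
    by (simp add: half_angle_def)
  then show ?thesis unfolding cis_mult by (simp add: complex_eq_iff)
qed

lemma half_angle_bounds: "0 < half_angle \<theta>1 \<theta>2" "half_angle \<theta>1 \<theta>2 < pi"
  using arc by (auto simp: half_angle_def)

text \<open>On the circle \<open>cnj (z - w) = - (z - w) * cnj z * cnj w\<close>, so this is the real number
  \<open>- cnj h * (z - \<zeta>) * cnj (z - w)\<close>.\<close>

definition weight :: "complex \<Rightarrow> real" where
  "weight z = Re (cnj h * (z - \<zeta>) * (z - w) * cnj z * cnj w)"

text \<open>Each chord is \<open>2 * \<i>\<close> times a real sine times the phase of a half sum of
  angles. All the phases multiply to -1, which cancels the sign of \<open>\<i>^2\<close>.\<close>

lemma weight_cis:
  "complex_of_real (4 * sin ((t - \<theta>1) / 2) * sin ((t - \<theta>2) / 2))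
     = cnj h * (cis t - \<zeta>) * (cis t - w) * cnj (cis t) * cnj w"
proof -
  have ph: "cnj h * cis ((t + \<theta>1) / 2) * cis ((t + \<theta>2) / 2) * cnj (cis t) * cnj w = -1"
  proof -
    have "cnj h * cis ((t + \<theta>1) / 2) * cis ((t + \<theta>2) / 2) * cnj (cis t) * cnj w = cis (- pi)"
      unfolding cis_cnj cis_mult by (rule arg_cong[of _ _ cis]) (simp add: half_angle_def field_simps)
    then show ?thesis by (simp add: complex_eq_iff)
  qed
  have "cnj h * (cis t - \<zeta>) * (cis t - w) * cnj (cis t) * cnj w
     = (2 * \<i> * of_real (sin ((t - \<theta>1) / 2))) * (2 * \<i> * of_real (sin ((t - \<theta>2) / 2)))
      * (cnj h * cis ((t + \<theta>1) / 2) * cis ((t + \<theta>2) / 2) * cnj (cis t) * cnj w)"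
    unfolding cis_diff_eq by (simp only: mult_ac)
  also have "\<dots> = complex_of_real (4 * sin ((t - \<theta>1) / 2) * sin ((t - \<theta>2) / 2))"
    unfolding ph by (simp add: complex_eq_iff)
  finally show ?thesis ..
qed

lemma weight_cis': "weight (cis t) = 4 * sin ((t - \<theta>1) / 2) * sin ((t - \<theta>2) / 2)"
  unfolding weight_def weight_cis[symmetric] by (rule Re_complex_of_real)

lemma weight_eq:
  assumes "z \<in> sphere 0 1"
  shows "complex_of_real (weight z) = cnj h * (z - \<zeta>) * (z - w) * cnj z * cnj w"
proof -
  obtain t where "z = cis t" using circle_eq_cis[OF assms] by blast
  then show ?thesis by (simp only: weight_cis' weight_cis)
qed

lemma continuous_weight: "continuous_on (sphere 0 1) weight"
  unfolding weight_def[abs_def] by (intro continuous_intros)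

lemma weight_finite_zeros: "finite {z\<in>sphere 0 1. weight z = 0}"
proof (rule finite_subset)
  show "{z\<in>sphere 0 1. weight z = 0} \<subseteq> {\<zeta>, w}"
  proof
    fix z assume "z \<in> {z\<in>sphere 0 1. weight z = 0}"
    then have z: "z \<in> sphere 0 1" "weight z = 0" by auto
    have "cnj h * (z - \<zeta>) * (z - w) * cnj z * cnj w = 0" using weight_eq[OF z(1)] z(2) by simp
    then show "z \<in> {\<zeta>, w}" using z(1) by auto
  qed
qed simp

text \<open>For angles \<open>t\<close> in a full turn from \<open>\<theta>1\<close>, the first sine
  is nonnegative and the second changes sign at \<open>\<theta>2\<close>.\<close>

lemma weight_neg_iff:
  assumes "z \<in> sphere 0 1"
  shows "weight z < 0 \<longleftrightarrow> z \<in> open_arc \<theta>1 \<theta>2"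
proof -
  have neg: "weight (cis t) < 0" if "\<theta>1 < t" "t < \<theta>2" for t
  proof -
    have "0 < sin ((t - \<theta>1) / 2)" using that arc by (intro sin_gt_zero) auto
    moreover have "0 < sin ((\<theta>2 - t) / 2)" using that arc by (intro sin_gt_zero) auto
    moreover have "sin ((t - \<theta>2) / 2) = - sin ((\<theta>2 - t) / 2)"
      by (metis minus_diff_eq minus_divide_left sin_minus)
    ultimately show ?thesis unfolding weight_cis' by (simp add: mult_pos_neg)
  qed
  obtain t where t: "\<theta>1 \<le> t" "t < \<theta>1 + 2 * pi" "z = cis t" using circle_eq_cis[OF assms] by blast
  show ?thesis
  proof
    assume z: "weight z < 0"
    have "t < \<theta>2"
    proof (rule ccontr)
      assume "\<not> t < \<theta>2"
      then have "0 \<le> sin ((t - \<theta>1) / 2)" "0 \<le> sin ((t - \<theta>2) / 2)"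
        using t arc by (auto intro!: sin_ge_zero)
      then have "0 \<le> weight z" unfolding t(3) weight_cis' by simp
      then show False using z by simp
    qed
    moreover have "t \<noteq> \<theta>1" using z unfolding t(3) weight_cis' by auto
    ultimately show "z \<in> open_arc \<theta>1 \<theta>2" using t by (force simp: open_arc_def)
  next
    assume "z \<in> open_arc \<theta>1 \<theta>2"
    then show "weight z < 0" using neg by (auto simp: open_arc_def)
  qed
qed

lemma supp_disjoint_iff: "supp \<mu> \<inter> open_arc \<theta>1 \<theta>2 = {} \<longleftrightarrow> (\<forall>z\<in>supp \<mu>. 0 \<le> weight z)"
proof -
  have "z \<in> sphere 0 1" if "z \<in> supp \<mu>" for z using that by (simp add: supp_def space_eq)
  then show ?thesis using weight_neg_iff by (meson disjoint_iff not_less)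
qed

text \<open>The factor \<open>cnj z\<close> of the weight moves to the second argument as
  multiplication by \<open>z\<close>, and the two linear factors join \<open>p\<close>. The signed
  form thus becomes an ordinary inner product.\<close>

lemma form_weight: "form weight p q = cnj h * cnj w * ip ([:- \<zeta>, 1:] * [:- w, 1:] * p) (pCons 0 q)"
proof -
  have "form weight p q = (LINT z|\<mu>. cnj h * cnj w *
      (of_real 1 * poly ([:- \<zeta>, 1:] * [:- w, 1:] * p) z * cnj (poly (pCons 0 q) z)))"
    unfolding form_def
  proof (rule Bochner_Integration.integral_cong)
    fix z assume "z \<in> space \<mu>"
    then have wz: "complex_of_real (weight z) = cnj h * (z - \<zeta>) * (z - w) * cnj z * cnj w"
      by (intro weight_eq) (simp add: space_eq)
    then show "of_real (weight z) * poly p z * cnj (poly q z) = cnj h * cnj w *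
      (of_real 1 * poly ([:- \<zeta>, 1:] * [:- w, 1:] * p) z * cnj (poly (pCons 0 q) z))"
      unfolding wz by (simp add: algebra_simps)
  qed simp
  then show ?thesis unfolding form_def by (simp only: integral_mult_right_zero)
qed

section \<open>The real three-term recurrence at the end point \<open>\<zeta>\<close>\<close>

definition y :: "nat \<Rightarrow> real" where
  "y n = x_point \<theta>1 \<theta>2 - c_coef \<alpha> \<theta>2 n * sqrt (1 - (x_point \<theta>1 \<theta>2)\<^sup>2)"

definition r :: "nat \<Rightarrow> real" where
  "r = three_term y (d_coef \<alpha> \<theta>2)"

lemma r_simps: "r 0 = 1" "r (Suc 0) = y (Suc 0)"
    "r (Suc (Suc n)) = y (Suc (Suc n)) * r (Suc n) - d_coef \<alpha> \<theta>2 (Suc (Suc n)) * r n"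
  by (simp_all add: r_def)

lemma sqrt_x_point: "sqrt (1 - (x_point \<theta>1 \<theta>2)\<^sup>2) = sin (half_angle \<theta>1 \<theta>2)"
proof -
  have "1 - (x_point \<theta>1 \<theta>2)\<^sup>2 = (sin (half_angle \<theta>1 \<theta>2))\<^sup>2"
    unfolding x_point_def by (simp add: sin_squared_eq)
  moreover have "0 \<le> sin (half_angle \<theta>1 \<theta>2)" using half_angle_bounds by (intro sin_ge_zero) auto
  ultimately show ?thesis by simp
qed

definition \<rho> :: "nat \<Rightarrow> real" where "\<rho> n = 1 - Re (aa n)"

lemma rho_pos: "0 < \<rho> n"
  using one_minus_a(3)[of \<theta>2 n] by (simp add: \<rho>_def)

text \<open>Since \<open>h * cnj h = 1\<close>, the left side is \<open>h\<close> times the sum of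
  \<open>h * (1 - aa n)\<close> and its conjugate. It is the leading coefficient of
  \<open>poly_S_rec\<close> at \<open>z = \<zeta>\<close>, where \<open>u = h * h\<close>.\<close>

lemma y_eq: "(1 - cnj (aa n)) + h * h * (1 - aa n) = 2 * h * of_real (\<rho> n * y (Suc n))"
proof -
  have yy: "\<rho> n * y (Suc n) = \<rho> n * cos (half_angle \<theta>1 \<theta>2) + Im (aa n) * sin (half_angle \<theta>1 \<theta>2)"
    using rho_pos[of n] unfolding y_def sqrt_x_point unfolding c_coef_def x_point_def \<rho>_def
    by (simp add: field_simps)
  have "h * cnj h = 1" using sphere_cnj_mult(1)[of h] by simp
  then have "(1 - cnj (aa n)) + h * h * (1 - aa n) = h * (cnj (h * (1 - aa n)) + h * (1 - aa n))"
    by (simp add: algebra_simps)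
  also have "cnj (h * (1 - aa n)) + h * (1 - aa n) = of_real (2 * Re (h * (1 - aa n)))"
    by (subst add.commute) (rule complex_add_cnj)
  also have "Re (h * (1 - aa n)) = \<rho> n * y (Suc n)" unfolding yy by (simp add: \<rho>_def algebra_simps)
  finally show ?thesis by simp
qed

text \<open>Follows from \<open>2 * \<rho> * g = |1 - aa|^2\<close> and
  \<open>2 * \<rho> * (1 - g) = 1 - |aa|^2\<close>; the right side is the numerator of the lower
  coefficient in \<open>poly_S_rec\<close>.\<close>

lemma d_coef_eq:
  "4 * \<rho> (Suc n) * \<rho> n * d_coef \<alpha> \<theta>2 (Suc (Suc n)) = (cmod (1 - aa (Suc n)))\<^sup>2 * (1 - (cmod (aa n))\<^sup>2)"
proof -
  have g: "2 * \<rho> n * g_coef \<alpha> \<theta>2 (Suc n) = (cmod (1 - aa n))\<^sup>2" for n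
    using rho_pos[of n] unfolding g_coef_def \<rho>_def diff_Suc_1 by (simp add: field_simps)
  have "(cmod (1 - aa n))\<^sup>2 = 1 - 2 * Re (aa n) + (cmod (aa n))\<^sup>2"
    unfolding cmod_power2 by (simp add: power2_eq_square algebra_simps)
  then have "2 * \<rho> n * (1 - g_coef \<alpha> \<theta>2 (Suc n)) = 1 - (cmod (aa n))\<^sup>2"
    unfolding right_diff_distrib g by (simp add: \<rho>_def)
  then show ?thesis
    unfolding g[of "Suc n", symmetric] by (simp add: d_coef_def)
qed

lemma d_coef_pos: "0 < d_coef \<alpha> \<theta>2 (Suc (Suc n))"
proof -
  have "0 < (cmod (1 - aa (Suc n)))\<^sup>2 * (1 - (cmod (aa n))\<^sup>2)"
    using one_minus_a(1)[of \<theta>2 "Suc n"] norm_a[of \<theta>2 n] 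
    by (intro mult_pos_pos) (auto simp: abs_square_less_1)
  then have "0 < 4 * \<rho> (Suc n) * \<rho> n * d_coef \<alpha> \<theta>2 (Suc (Suc n))" unfolding d_coef_eq .
  then show ?thesis by (rule zero_less_mult_pos) (simp add: rho_pos)
qed

abbreviation SS where "SS \<equiv> S \<theta>2"

lemma zeta_ne_w: "\<zeta> \<noteq> w"
proof
  assume "\<zeta> = w"
  then have "sin ((\<theta>2 - \<theta>1) / 2) = 0" using cis_diff_eq[of \<theta>2 \<theta>1] by simp
  moreover have "0 < sin ((\<theta>2 - \<theta>1) / 2)" using arc by (intro sin_gt_zero) auto
  ultimately show False by simp
qed

text \<open>Normalises each step of \<open>poly_S_rec\<close> so that the coefficients at
  \<open>\<zeta>\<close> become \<open>y\<close> and \<open>d_coef\<close>.\<close>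

definition scale :: "nat \<Rightarrow> complex" where
  "scale n = (\<Prod>k<n. (1 - cnj (aa k)) / (2 * h * of_real (\<rho> k)))"

lemma scale_nonzero: "scale n \<noteq> 0"
  using one_minus_a(2)[of \<theta>2] rho_pos unfolding scale_def
  by (auto simp: prod_zero_iff less_le)

lemma scale_Suc: "scale (Suc n) * (2 * h * of_real (\<rho> n)) = scale n * (1 - cnj (aa n))"
  using rho_pos[of n] by (simp add: scale_def)

lemma zeta_sphere: "\<zeta> \<in> sphere 0 1"
  by simp

text \<open>After scaling, \<open>y_eq\<close> and \<open>d_coef_eq\<close> turn the recurrence of
  \<open>S n\<close> at \<open>\<zeta>\<close> into that of \<open>r\<close>, starting from
  \<open>1 - \<zeta> * cnj w = 1 - h * h\<close>.\<close>

lemma S_zeta: "poly (SS n) \<zeta> * scale n = (1 - h * h) * of_real (r n)"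
proof -
  have u: "\<zeta> / cis \<theta>2 = h * h" unfolding h_sq[symmetric] by simp
  have "\<zeta> * cnj w = h * h * (w * cnj w)" unfolding h_sq[symmetric] by (simp only: mult_ac)
  then have "\<zeta> * cnj w = h * h" using sphere_cnj_mult(1)[of w] by simp
  moreover have "Phi_star 0 = 1" by (simp add: Phi_star_def Phi_0)
  ultimately have base: "poly (SS 0) \<zeta> * scale 0 = (1 - h * h) * of_real (r 0)"
    by (simp add: S_def Phi_0 scale_def r_simps)
  show ?thesis
  proof (induction n rule: induct_nat_012)
    case 0
    show ?case by (rule base)
  next
    case 1
    let ?k = "2 * h * complex_of_real (\<rho> 0)"
    have k: "?k \<noteq> 0" using rho_pos[of 0] by simp
    have "?k * (poly (SS 1) \<zeta> * scale 1) = scale (Suc 0) * ?k * poly (SS 1) \<zeta>"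
      by (simp only: One_nat_def mult_ac)
    also have "\<dots> = (1 - cnj (aa 0)) * poly (SS 1) \<zeta> * scale 0"
      unfolding scale_Suc by (simp only: mult_ac)
    also have "\<dots> = ?k * (of_real (y 1) * (poly (SS 0) \<zeta> * scale 0))"
      unfolding poly_S_rec(1)[OF zeta_sphere] u y_eq by (simp add: mult_ac)
    also have "\<dots> = ?k * ((1 - h * h) * of_real (r 1))"
      unfolding base by (simp add: r_simps)
    finally show ?case using k by (simp only: mult_cancel_left One_nat_def) simp
  next
    case (ge2 n)
    let ?k = "2 * h * complex_of_real (\<rho> (Suc n))"
    let ?d = "d_coef \<alpha> \<theta>2 (Suc (Suc n))"
    have k: "?k \<noteq> 0" using rho_pos[of "Suc n"] by simp
    have d: "of_real ((cmod (1 - aa (Suc n)))\<^sup>2) * complex_of_real (1 - (cmod (aa n))\<^sup>2)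
        = of_real (4 * \<rho> (Suc n) * \<rho> n * ?d)"
      unfolding d_coef_eq by simp
    have sc: "scale (Suc n) * (2 * h * of_real (\<rho> n)) / (1 - cnj (aa n)) = scale n"
      unfolding scale_Suc using one_minus_a(2)[of \<theta>2 n] by simp
    have "?k * (poly (SS (Suc (Suc n))) \<zeta> * scale (Suc (Suc n)))
        = scale (Suc (Suc n)) * ?k * poly (SS (Suc (Suc n))) \<zeta>"
      by (simp only: mult_ac)
    also have "\<dots> = (1 - cnj (aa (Suc n))) * poly (SS (Suc (Suc n))) \<zeta> * scale (Suc n)"
      unfolding scale_Suc by (simp only: mult_ac)
    also have "\<dots> = ?k * (of_real (y (Suc (Suc n))) * (poly (SS (Suc n)) \<zeta> * scale (Suc n)))
       - h * h * (of_real ((cmod (1 - aa (Suc n)))\<^sup>2) * complex_of_real (1 - (cmod (aa n))\<^sup>2))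
        / (1 - cnj (aa n)) * poly (SS n) \<zeta> * scale (Suc n)"
      unfolding poly_S_rec(2)[OF zeta_sphere] u y_eq by (simp add: algebra_simps del: tau.simps)
    \<comment> \<open>\<open>4 * h * h\<close> is split into two factors \<open>2 * h\<close>: one
      belongs to \<open>?k\<close>, the other takes \<open>scale (Suc n)\<close> back to
      \<open>scale n\<close>.\<close>
    also have "\<dots> = ?k * (of_real (y (Suc (Suc n))) * (poly (SS (Suc n)) \<zeta> * scale (Suc n)))
       - ?k * (of_real ?d * (poly (SS n) \<zeta> * (scale (Suc n) * (2 * h * of_real (\<rho> n)) / (1 - cnj (aa n)))))"
      unfolding d by (simp add: algebra_simps del: tau.simps)
    also have "\<dots> = ?k * (of_real (y (Suc (Suc n))) * ((1 - h * h) * of_real (r (Suc n)))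
        - of_real ?d * ((1 - h * h) * of_real (r n)))"
      unfolding sc ge2 by (simp only: right_diff_distrib)
    also have "\<dots> = ?k * ((1 - h * h) * of_real (r (Suc (Suc n))))"
      unfolding r_simps(3) of_real_diff of_real_mult by (simp only: algebra_simps)
    finally show ?case using k by (simp only: mult_cancel_left) simp
  qed
qed

lemma S_zeta_nonzero: "poly (SS n) \<zeta> \<noteq> 0 \<longleftrightarrow> r n \<noteq> 0"
proof -
  have "1 - h * h \<noteq> 0"
  proof
    assume "1 - h * h = 0"
    then have "h * h = 1" by simp
    then show False using h_sq zeta_ne_w by simp
  qed
  then show ?thesis using S_zeta[of n] scale_nonzero[of n]
    by (metis mult_eq_0_iff of_real_eq_0_iff)
qed

text \<open>The witness is \<open>(S (n + 1) - \<kappa> * S n) / ((z - \<zeta>) * (z - w))\<close>, with \<open>\<kappa>\<close> chosen to make the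
  numerator vanish at \<open>\<zeta>\<close>.\<close>

lemma weight_orthogonal_poly:
  assumes rn: "r n \<noteq> 0"
  obtains Q where "degree Q = n" "coeff Q n \<noteq> 0"
    "\<And>q. \<forall>k\<ge>n. coeff q k = 0 \<Longrightarrow> form weight Q q = 0"
    "form weight Q Q = of_real (2 * \<rho> n * sqnorm n * - (r (Suc n) / r n))"
proof -
  have S0: "poly (SS n) \<zeta> \<noteq> 0" using rn S_zeta_nonzero by simp
  define \<kappa> where "\<kappa> = poly (SS (Suc n)) \<zeta> / poly (SS n) \<zeta>"
  define F where "F = SS (Suc n) - smult \<kappa> (SS n)"
  have "poly F \<zeta> = 0" "poly F w = 0" using S0 by (simp_all add: F_def \<kappa>_def)
  then obtain Q where Q: "F = [:- \<zeta>, 1:] * [:- w, 1:] * Q" using two_roots_dvd zeta_ne_w by blast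
  have cF: "coeff F (Suc (Suc n)) = - cnj (tau \<alpha> \<theta>2 (Suc n))"
    unfolding F_def coeff_diff coeff_smult by (simp del: tau.simps)
  have tnz: "cnj (tau \<alpha> \<theta>2 (Suc n)) \<noteq> 0" using norm_tau[of \<theta>2 "Suc n"] by auto
  have dF: "degree F = Suc (Suc n)"
  proof (rule antisym)
    show "degree F \<le> Suc (Suc n)" by (rule degree_le) (simp add: F_def)
    show "Suc (Suc n) \<le> degree F" using cF tnz by (intro le_degree) auto
  qed
  then have "Q \<noteq> 0" using Q by auto
  then have dQ: "degree Q = n" using dF unfolding Q mult.assoc by (simp add: degree_mult_eq del: mult_pCons_left)
  have cQ: "coeff Q n = - cnj (tau \<alpha> \<theta>2 (Suc n))"
  proof -
    have "lead_coeff F = lead_coeff Q" unfolding Q lead_coeff_mult by simp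
    then show ?thesis unfolding dF dQ cF by simp
  qed
  have fQ: "form weight Q q = - (cnj h * cnj w * \<kappa> * cnj (coeff q n) * of_real (sqnorm n)
      * (\<alpha> n - cnj (tau \<alpha> \<theta>2 n)))" if q: "\<forall>k>n. coeff q k = 0" for q
  proof -
    \<comment> \<open>At index \<open>n + 1\<close>, \<open>ip_S\<close> reads the coefficient
      \<open>n + 1\<close> of \<open>q\<close>, which is 0; only \<open>- \<kappa> * S n\<close>
      contributes.\<close>
    have "ip (SS (Suc n)) (pCons 0 q) = 0" using q by (subst ip_S) auto
    then show ?thesis
      unfolding form_weight Q[symmetric] F_def using ip_S[OF q, of \<theta>2]
      by (simp only: ip_linear form_smult) (simp add: mult.assoc)
  qed
  have kappa: "\<kappa> * (1 - cnj (aa n)) = 2 * h * of_real (\<rho> n * (r (Suc n) / r n))"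
  proof -
    have nz: "1 - h * h \<noteq> 0" using S_zeta[of n] S0 scale_nonzero[of n] by auto
    have X: "poly (SS (Suc n)) \<zeta> * scale (Suc n) * (2 * h * of_real (\<rho> n))
        = poly (SS (Suc n)) \<zeta> * (scale n * (1 - cnj (aa n)))"
      unfolding scale_Suc[symmetric] by (simp only: mult.assoc)
    have "\<kappa> * (1 - cnj (aa n))
        = poly (SS (Suc n)) \<zeta> * (scale n * (1 - cnj (aa n))) / (poly (SS n) \<zeta> * scale n)"
      using scale_nonzero[of n] unfolding \<kappa>_def by simp
    also have "\<dots> = (poly (SS (Suc n)) \<zeta> * scale (Suc n)) * (2 * h * of_real (\<rho> n)) / (poly (SS n) \<zeta> * scale n)"
      by (simp only: X)
    also have "\<dots> = 2 * h * of_real (\<rho> n * (r (Suc n) / r n))"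
      unfolding S_zeta using nz by simp
    finally show ?thesis .
  qed
  show ?thesis
  proof
    show "degree Q = n" by (rule dQ)
    show "coeff Q n \<noteq> 0" using cQ tnz by simp
    show "form weight Q q = 0" if "\<forall>k\<ge>n. coeff q k = 0" for q
      using that by (subst fQ) auto
    have t1: "tau \<alpha> \<theta>2 n * cnj (tau \<alpha> \<theta>2 n) = 1" by (rule tau_cnj)
    \<comment> \<open>The conjugate leading coefficient of \<open>Q\<close> brings in
      \<open>tau (n + 1)\<close>. Its recursion produces the factor \<open>1 - cnj (aa n)\<close>
      required by \<open>kappa\<close>, and the remaining phases cancel.\<close>
    have "form weight Q Q = cnj h * cnj w * \<kappa> * of_real (sqnorm n) * (tau \<alpha> \<theta>2 (Suc n) * (\<alpha> n - cnj (tau \<alpha> \<theta>2 n)))"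
      using dQ by (subst fQ) (auto simp: coeff_eq_0 cQ mult.assoc simp del: tau.simps)
    also have "\<alpha> n - cnj (tau \<alpha> \<theta>2 n) = - cnj (tau \<alpha> \<theta>2 n) * (1 - aa n)"
      using t1 by algebra
    also have "tau \<alpha> \<theta>2 (Suc n) * (- cnj (tau \<alpha> \<theta>2 n) * (1 - aa n))
       = - (tau \<alpha> \<theta>2 n * cnj (tau \<alpha> \<theta>2 n)) * w * (1 - cnj (aa n))"
      using tau_Suc[of \<theta>2 n] by (simp only: mult_minus_left mult_minus_right) (simp only: mult_ac)
    also have "\<dots> = - w * (1 - cnj (aa n))" unfolding t1 by simp
    also have "cnj h * cnj w * \<kappa> * of_real (sqnorm n) * (- w * (1 - cnj (aa n)))
       = - (w * cnj w) * cnj h * of_real (sqnorm n) * (\<kappa> * (1 - cnj (aa n)))"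
      by (simp only: mult_minus_left mult_minus_right mult_ac)
    also have "\<dots> = - (w * cnj w) * (h * cnj h) * of_real (sqnorm n) * (2 * of_real (\<rho> n * (r (Suc n) / r n)))"
      unfolding kappa by (simp only: mult_minus_left mult_minus_right mult_ac)
    also have "\<dots> = of_real (2 * \<rho> n * sqnorm n * - (r (Suc n) / r n))"
      using sphere_cnj_mult(1)[of w] sphere_cnj_mult(1)[of h] by simp
    finally show "form weight Q Q = of_real (2 * \<rho> n * sqnorm n * - (r (Suc n) / r n))" .
  qed
qed

text \<open>The polynomials \<open>Q\<close> diagonalise the form, with diagonal entries of the sign
  of \<open>- r (Suc n) / r n\<close>. A nonnegative weight on the support makes them positive;
  conversely, positive entries make the form nonnegative, which \<open>form_nonneg_imp\<close>
  carries over to the weight.\<close>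

lemma supp_disjoint_iff_ratio:
  "supp \<mu> \<inter> open_arc \<theta>1 \<theta>2 = {} \<longleftrightarrow> (\<forall>n. r (Suc n) / r n < 0)"
  unfolding supp_disjoint_iff
proof
  assume nonneg: "\<forall>z\<in>supp \<mu>. 0 \<le> weight z"
  have ratio: "r (Suc n) / r n < 0" if "r n \<noteq> 0" for n
  proof -
    obtain Q where Q: "coeff Q n \<noteq> 0"
      "form weight Q Q = of_real (2 * \<rho> n * sqnorm n * - (r (Suc n) / r n))"
      using weight_orthogonal_poly[OF \<open>r n \<noteq> 0\<close>] by blast
    have "0 < Re (form weight Q Q)"
      by (rule form_pos[OF continuous_weight weight_finite_zeros]) (use nonneg Q(1) in auto)
    then have "0 < 2 * \<rho> n * sqnorm n * - (r (Suc n) / r n)" unfolding Q(2) Re_complex_of_real .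
    then have "0 < - (r (Suc n) / r n)"
      by (rule zero_less_mult_pos) (simp add: rho_pos sqnorm_pos)
    then show ?thesis by simp
  qed
  \<comment> \<open>A negative ratio has a nonzero numerator, so the next \<open>Q\<close>
    exists.\<close>
  have "r n \<noteq> 0" for n
  proof (induction n)
    case (Suc n)
    then show ?case using ratio[of n] by auto
  qed (simp add: r_simps)
  then show "\<forall>n. r (Suc n) / r n < 0" using ratio by blast
next
  assume ratio: "\<forall>n. r (Suc n) / r n < 0"
  have nonneg: "0 \<le> Re (form weight p p)" if "\<forall>k\<ge>n. coeff p k = 0" for p n
    using that
  proof (induction n arbitrary: p)
    case 0
    then have "p = 0" by (auto intro: poly_eqI)
    then show ?case by simp
  next
    case (Suc n)
    have "r n \<noteq> 0" using ratio[rule_format, of n] by auto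
    then obtain Q where Q: "degree Q = n" "coeff Q n \<noteq> 0"
      "\<And>q. \<forall>k\<ge>n. coeff q k = 0 \<Longrightarrow> form weight Q q = 0"
      "form weight Q Q = of_real (2 * \<rho> n * sqnorm n * - (r (Suc n) / r n))"
      using weight_orthogonal_poly by blast
    \<comment> \<open>Splits off the \<open>Q\<close> component; the remainder has lower degree and
      is orthogonal to \<open>Q\<close>.\<close>
    define c where "c = coeff p n / coeff Q n"
    define q where "q = p - smult c Q"
    have q: "\<forall>k\<ge>n. coeff q k = 0"
    proof (intro allI impI)
      fix k assume "n \<le> k"
      then show "coeff q k = 0" using Suc.prems Q(1,2)
        by (cases "k = n") (simp_all add: q_def c_def coeff_eq_0)
    qed
    have "form weight q Q = 0" by (subst form_cnj) (simp add: Q(3)[OF q])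
    moreover have p: "p = smult c Q + q" by (simp add: q_def)
    ultimately have "form weight p p = c * cnj c * form weight Q Q + form weight q q"
      using Q(3)[OF q] unfolding p by (simp add: form_add[OF continuous_weight] algebra_simps)
    also have "c * cnj c * form weight Q Q = of_real ((cmod c)\<^sup>2 * (2 * \<rho> n * sqnorm n * - (r (Suc n) / r n)))"
      unfolding Q(4) complex_norm_square[symmetric] by simp
    finally have "Re (form weight p p) = (cmod c)\<^sup>2 * (2 * \<rho> n * sqnorm n * - (r (Suc n) / r n)) + Re (form weight q q)"
      by simp
    moreover have "0 \<le> - (r (Suc n) / r n)" using ratio[rule_format, of n] by simp
    then have "0 \<le> (cmod c)\<^sup>2 * (2 * \<rho> n * sqnorm n * - (r (Suc n) / r n))"
      using rho_pos[of n] sqnorm_pos[of n] by (intro mult_nonneg_nonneg zero_le_power2) simp_all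
    ultimately show ?case using Suc.IH[OF q] by linarith
  qed
  have "0 \<le> Re (form weight p p)" for p
    by (rule nonneg[of "Suc (degree p)"]) (auto simp: coeff_eq_0)
  then show "\<forall>z\<in>supp \<mu>. 0 \<le> weight z" using form_nonneg_imp[OF continuous_weight] by blast
qed

end

theorem theorem1p2:
  fixes \<mu> :: "complex measure" and \<alpha> :: "nat \<Rightarrow> complex" and \<theta>1 \<theta>2 :: real
  assumes "circle_measure \<mu>" and "nontrivial \<mu>"
    and "is_verblunsky \<mu> \<alpha>"
    and "0 < \<theta>2 - \<theta>1" and "\<theta>2 - \<theta>1 \<le> 2 * pi"
    and "0 < \<theta>2" and "\<theta>2 \<le> 2 * pi"
  shows "supp \<mu> \<inter> open_arc \<theta>1 \<theta>2 = {} \<longleftrightarrow>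
    ecot (half_angle \<theta>1 \<theta>2) < ereal (c_coef \<alpha> \<theta>2 1) \<and>
    (\<forall>n\<ge>1. m_defined \<alpha> \<theta>1 \<theta>2 n \<and>
            0 < m_seq \<alpha> \<theta>1 \<theta>2 n \<and> m_seq \<alpha> \<theta>1 \<theta>2 n < 1)"
proof -
  interpret nontrivial_circle_measure \<mu> using assms(1,2) by unfold_locales
  obtain \<Phi> where \<Phi>: "monic_orthogonal_polys \<mu> \<Phi>" "\<forall>n\<ge>1. \<alpha> (n - 1) = - cnj (poly (\<Phi> n) 0)"
    using assms(3) unfolding is_verblunsky_def by blast
  have "\<alpha> n = - cnj (poly (\<Phi> (Suc n)) 0)" for n using \<Phi>(2)[rule_format, of "Suc n"] by simp
  then interpret circle_orthogonal_polys \<mu> \<Phi> \<alpha> using \<Phi>(1) by unfold_locales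
  show ?thesis
  proof (cases "\<theta>2 - \<theta>1 = 2 * pi")
    \<comment> \<open>The arc is the circle without one point, so the infinite support meets it; the
      other side fails too, since \<open>ecot 0\<close> is infinite.\<close>
    case True
    have "supp \<mu> - {cis \<theta>1} \<subseteq> open_arc \<theta>1 \<theta>2"
    proof
      fix z assume z: "z \<in> supp \<mu> - {cis \<theta>1}"
      then have "z \<in> sphere 0 1" by (simp add: supp_def space_eq)
      then obtain t where "\<theta>1 \<le> t" "t < \<theta>1 + 2 * pi" "z = cis t" by (rule circle_eq_cis)
      then show "z \<in> open_arc \<theta>1 \<theta>2" using z True unfolding open_arc_def by (intro CollectI exI[of _ t]) (auto simp: order_less_le)
    qed
    moreover have "infinite (supp \<mu> - {cis \<theta>1})" using assms(2) by (simp add: nontrivial_def)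
    ultimately have "supp \<mu> \<inter> open_arc \<theta>1 \<theta>2 \<noteq> {}"
      by (metis Diff_subset finite.emptyI inf.absorb_iff1 inf_assoc inf_bot_right inf.commute)
    moreover have "half_angle \<theta>1 \<theta>2 = 0" using True by (simp add: half_angle_def)
    ultimately show ?thesis by (simp add: ecot_def)
  next
    case False
    then interpret circle_arc \<mu> \<Phi> \<alpha> \<theta>1 \<theta>2 using assms(4,5) by unfold_locales auto
    have sin: "0 < sin (half_angle \<theta>1 \<theta>2)" using half_angle_bounds by (rule sin_gt_zero)
    have "ecot (half_angle \<theta>1 \<theta>2) < ereal (c_coef \<alpha> \<theta>2 1) \<longleftrightarrow> cot (half_angle \<theta>1 \<theta>2) < c_coef \<alpha> \<theta>2 1"
      using half_angle_bounds by (simp add: ecot_def)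
    \<comment> \<open>Multiply by the positive sine, which is the square root occurring in
      \<open>y\<close>.\<close>
    also have "\<dots> \<longleftrightarrow> y 1 < 0"
      using sin unfolding y_def sqrt_x_point by (simp add: x_point_def cot_def field_simps)
    finally have e: "ecot (half_angle \<theta>1 \<theta>2) < ereal (c_coef \<alpha> \<theta>2 1) \<longleftrightarrow> y 1 < 0" .
    have m: "m_defined \<alpha> \<theta>1 \<theta>2 n \<longleftrightarrow> y n \<noteq> 0 \<and> y (n + 1) \<noteq> 0 \<and> 1 - m_seq \<alpha> \<theta>1 \<theta>2 (n - 1) \<noteq> 0" for n
      by (simp add: m_defined_def y_def Let_def)
    show ?thesis
      unfolding supp_disjoint_iff_ratio e m r_def
      by (rule chain_sequence_iff[symmetric])
         (simp_all add: d_coef_pos d_frak_def y_def)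
  qed
qed

end
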